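(* Let $\mathcal A\subseteq B(\mathcal H)$ be a von Neumann algebra and let $\tau:\mathcal A\to\mathcal A$ be a normal unital completely positive map. Then $x\mapsto\tau(x)$ is an automorphism ($*$-automorphism) of the peripheral Poisson boundary $C^*$-algebra $(\mathcal P(\tau),\circ)$. The peripheral Poisson boundary of this automorphism is $\mathcal P(\tau)$ itself.
   Context: All Hilbert spaces are complex and separable; $\mathbb T=\{z\in\mathbb C:|z|=1\}$. For Hilbert spaces $\mathcal H\subseteq\mathcal K$ with $p$ the orthogonal projection of $\mathcal K$ onto $\mathcal H$, an operator $x\in B(\mathcal H)$ is identified with $pxp\in B(\mathcal K)$. Minimal dilation: it is known that for every normal unital completely positive map $\tau$ on a von Neumann algebra $\mathcal A\subseteq B(\mathcal H)$ there is a triple $(\mathcal K,\mathcal B,\theta)$, unique up to unitary equivalence fixing $\mathcal H$ pointwise, such that: $\mathcal K\supseteq\mathcal H$ is a Hilbert space containing $\mathcal H$ as a closed subspace; $\mathcal B\subseteq B(\mathcal K)$ is a von Neumann algebra with $\mathcal A=p\mathcal Bp$ (so $p$ is the identity of $\mathcal A$); $\theta:\mathcal B\to\mathcal B$ is a normal unital $*$-endomorphism; $\tau^n(x)=p\theta^n(x)p$ for all $x\in\mathcal A$, $n\in\mathbb Z_+$; $\mathcal K$ is the closed linear span of $\{\theta^n(x_n)\cdots\theta(x_1)h: x_i\in\mathcal A,\ h\in\mathcal H,\ n\in\mathbb Z_+\}$; and $\mathcal B$ is the von Neumann algebra generated by $\{\theta^n(x):n\in\mathbb Z_+,x\in\mathcal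 A\}$. Peripheral Poisson boundary: $\mathcal P(\tau)$ is the operator norm closure of $\mathrm{span}\{x\in\mathcal A:\tau(x)=\lambda x\text{ for some }\lambda\in\mathbb T\}$, and $\mathcal P(\theta)$ is the operator norm closure of $\mathrm{span}\{x\in\mathcal B:\theta(x)=\lambda x\text{ for some }\lambda\in\mathbb T\}$, which is a unital $C^*$-algebra. The compression $T:\mathcal P(\theta)\to\mathcal P(\tau)$, $T(z)=pzp$, is an isometric bijection, and the product $x\circ y:=T(T^{-1}(x)T^{-1}(y))$ makes $\mathcal P(\tau)$ (with unchanged norm and involution) a unital $C^*$-algebra, called the peripheral Poisson boundary of $\tau$. For a $*$-automorphism $\alpha$ of a unital $C^*$-algebra $\mathcal C$, its peripheral Poisson boundary means the $C^*$-algebra $\overline{\mathrm{span}}\{x\in\mathcal C:\alpha(x)=\lambda x\text{ for some }\lambda\in\mathbb T\}$ (norm closure) with the product of $\mathcal C$. *)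

theory Defs
  imports "HOL-Analysis.Analysis"
begin

section \<open>Complex Hilbert spaces\<close>

class scaleC =
  fixes scaleC :: "complex \<Rightarrow> 'a \<Rightarrow> 'a"  (infixr \<open>*\<^sub>C\<close> 75)

class complex_vector = real_vector + scaleC +
  assumes scaleC_add_right: "c *\<^sub>C (x + y) = c *\<^sub>C x + c *\<^sub>C y"
    and scaleC_add_left: "(c + d) *\<^sub>C x = c *\<^sub>C x + d *\<^sub>C x"
    and scaleC_scaleC: "c *\<^sub>C (d *\<^sub>C x) = (c * d) *\<^sub>C x"
    and scaleC_of_real: "complex_of_real r *\<^sub>C x = r *\<^sub>R x"

lemma scaleC_one: "1 *\<^sub>C x = (x :: 'a::complex_vector)"
  using scaleC_of_real[of 1 x] by simp

global_interpretation complex_vector: vector_space "scaleC :: complex \<Rightarrow> 'a \<Rightarrow> 'a::complex_vector"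
  defines csubspace = complex_vector.subspace
    and cspan = complex_vector.span
  by unfold_locales (auto simp: scaleC_add_right scaleC_add_left scaleC_scaleC scaleC_one)

class complex_normed_vector = complex_vector + real_normed_vector +
  assumes norm_scaleC: "norm (c *\<^sub>C x) = cmod c * norm x"

text \<open>The inner product is linear in its second argument. Its real part is the real inner product
  inherited from \<^class>\<open>real_inner\<close>, which makes it positive definite and ties it to the norm.\<close>

class complex_inner = complex_vector + real_inner +
  fixes cinner :: "'a \<Rightarrow> 'a \<Rightarrow> complex"
  assumes cinner_commute: "cinner x y = cnj (cinner y x)"
    and cinner_add_right: "cinner x (y + z) = cinner x y + cinner x z"
    and cinner_scaleC_right: "cinner x (c *\<^sub>C y) = c * cinner x y"
    and Re_cinner: "Re (cinner x y) = x \<bullet> y"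
begin

lemma cinner_self: "cinner x x = complex_of_real ((norm x)\<^sup>2)"
proof -
  have "Im (cinner x x) = 0"
    using cinner_commute[of x x] by (metis add.inverse_unique cnj.sel(2) mult_2 mult_eq_0_iff
        neg_equal_zero)
  then show ?thesis
    by (simp add: complex_eq_iff Re_cinner power2_norm_eq_inner)
qed

lemma cinner_scaleC_left: "cinner (c *\<^sub>C x) y = cnj c * cinner x y"
  by (metis cinner_commute cinner_scaleC_right complex_cnj_mult)

end

instance complex_inner \<subseteq> complex_normed_vector
proof
  fix c :: complex and x :: 'a
  have "complex_of_real ((norm (c *\<^sub>C x))\<^sup>2) = (c * cnj c) * cinner x x"
    unfolding cinner_self[symmetric] by (simp add: cinner_scaleC_left cinner_scaleC_right)
  also have "\<dots> = complex_of_real ((cmod c * norm x)\<^sup>2)"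
    by (simp add: cinner_self power_mult_distrib flip: complex_norm_square)
  finally have "(norm (c *\<^sub>C x))\<^sup>2 = (cmod c * norm x)\<^sup>2"
    using of_real_eq_iff by blast
  then show "norm (c *\<^sub>C x) = cmod c * norm x"
    by (simp add: power2_eq_iff_nonneg)
qed

class chilbert_space = complex_inner + complete_space

instantiation complex :: chilbert_space
begin

definition scaleC_complex :: "complex \<Rightarrow> complex \<Rightarrow> complex" where
  "scaleC_complex c x = c * x"

definition cinner_complex :: "complex \<Rightarrow> complex \<Rightarrow> complex" where
  "cinner_complex x y = cnj x * y"

instance
  by standard
    (auto simp: scaleC_complex_def cinner_complex_def algebra_simps scaleR_conv_of_real
        inner_complex_def)

end


section \<open>Bounded operators\<close>

text \<open>The type \<open>'a \<Rightarrow>\<^sub>L 'b\<close> consists of the bounded \<^emph>\<open>real\<close>-linear maps; \<open>bops\<close> is its closed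
  complex subspace of complex-linear ones, so that \<open>bops :: ('a \<Rightarrow>\<^sub>L 'a) set\<close> is $B(\mathcal H)$.
  The norm of \<open>'a \<Rightarrow>\<^sub>L 'b\<close> is the operator norm.\<close>

definition bops :: "('a::complex_normed_vector \<Rightarrow>\<^sub>L 'b::complex_normed_vector) set" where
  "bops = {x. \<forall>c v. blinfun_apply x (c *\<^sub>C v) = c *\<^sub>C blinfun_apply x v}"

lemma bounded_linear_scaleC: "bounded_linear (\<lambda>x. c *\<^sub>C (x :: 'a::complex_normed_vector))"
proof (rule bounded_linear_intro[where K = "cmod c"])
  fix r and x :: 'a
  show "c *\<^sub>C (r *\<^sub>R x) = r *\<^sub>R (c *\<^sub>C x)"
    by (metis mult.commute scaleC_of_real scaleC_scaleC)
qed (auto simp: scaleC_add_right norm_scaleC)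

instantiation blinfun :: (real_normed_vector, complex_normed_vector) complex_normed_vector
begin

lift_definition scaleC_blinfun :: "complex \<Rightarrow> 'a \<Rightarrow>\<^sub>L 'b \<Rightarrow> 'a \<Rightarrow>\<^sub>L 'b" is "\<lambda>c f v. c *\<^sub>C f v"
  by (rule bounded_linear_compose[OF bounded_linear_scaleC])

instance
proof
  fix c d :: complex and r :: real and x y :: "'a \<Rightarrow>\<^sub>L 'b"
  show "c *\<^sub>C (x + y) = c *\<^sub>C x + c *\<^sub>C y"
    by transfer (simp add: scaleC_add_right)
  show "(c + d) *\<^sub>C x = c *\<^sub>C x + d *\<^sub>C x"
    by transfer (simp add: scaleC_add_left)
  show "c *\<^sub>C (d *\<^sub>C x) = (c * d) *\<^sub>C x"
    by transfer (simp add: scaleC_scaleC)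
  show "complex_of_real r *\<^sub>C x = r *\<^sub>R x"
    by transfer (simp add: scaleC_of_real)
  show "norm (c *\<^sub>C x) = cmod c * norm x"
  proof transfer
    fix c :: complex and f :: "'a \<Rightarrow> 'b" assume "bounded_linear f"
    have "onorm (\<lambda>v. c *\<^sub>C f v) = onorm (\<lambda>v. cmod c *\<^sub>R f v)"
      by (simp add: onorm_def norm_scaleC)
    also have "\<dots> = cmod c * onorm f"
      using onorm_scaleR[OF \<open>bounded_linear f\<close>, of "cmod c"] by simp
    finally show "onorm (\<lambda>v. c *\<^sub>C f v) = cmod c * onorm f" .
  qed
qed

end

definition adj :: "('a::chilbert_space \<Rightarrow>\<^sub>L 'b::chilbert_space) \<Rightarrow> ('b \<Rightarrow>\<^sub>L 'a)" where
  "adj x = (THE y. \<forall>u v. cinner (blinfun_apply x u) v = cinner u (blinfun_apply y v))"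

text \<open>The weak operator topology and the \<open>\<sigma>\<close>-weak (ultraweak) topology of $B(\mathcal H)$ are the
  initial topologies of the functionals $x \mapsto \langle\xi, x\eta\rangle$ and
  $x \mapsto \sum_n \langle\xi_n, x\eta_n\rangle$, the latter for square summable sequences.\<close>

definition wot :: "('a::chilbert_space \<Rightarrow>\<^sub>L 'a) topology" where
  "wot = pullback_topology bops (\<lambda>x. \<lambda>(\<xi>, \<eta>). cinner \<xi> (blinfun_apply x \<eta>)) euclidean"

definition square_summable :: "(nat \<Rightarrow> 'a::real_normed_vector) \<Rightarrow> bool" where
  "square_summable \<xi> \<longleftrightarrow> summable (\<lambda>n. (norm (\<xi> n))\<^sup>2)"

definition sigma_weak :: "('a::chilbert_space \<Rightarrow>\<^sub>L 'a) topology" where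
  "sigma_weak = pullback_topology bops
     (\<lambda>x. \<lambda>(\<xi>, \<eta>). if square_summable \<xi> \<and> square_summable \<eta>
                    then \<Sum>n. cinner (\<xi> n) (blinfun_apply x (\<eta> n)) else 0)
     euclidean"

definition von_neumann_algebra :: "('a::chilbert_space \<Rightarrow>\<^sub>L 'a) set \<Rightarrow> bool" where
  "von_neumann_algebra M \<longleftrightarrow>
     M \<subseteq> bops \<and> csubspace M \<and> id_blinfun \<in> M \<and>
     (\<forall>x\<in>M. \<forall>y\<in>M. x o\<^sub>L y \<in> M) \<and> (\<forall>x\<in>M. adj x \<in> M) \<and> closedin wot M"

definition generated_von_neumann_algebra ::
    "('a::chilbert_space \<Rightarrow>\<^sub>L 'a) set \<Rightarrow> ('a \<Rightarrow>\<^sub>L 'a) set" where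
  "generated_von_neumann_algebra S = \<Inter>{M. von_neumann_algebra M \<and> S \<subseteq> M}"


section \<open>Unital C*-algebras and their homomorphisms\<close>

text \<open>The vector space operations and the norm of a C*-algebra are those of the ambient type; the
  product, the unit and the involution are part of the structure.\<close>

record 'a star_structure =
  cs_carrier :: "'a set"
  cs_mult :: "'a \<Rightarrow> 'a \<Rightarrow> 'a"  (infixl \<open>\<otimes>\<index>\<close> 70)
  cs_one :: "'a"  (\<open>\<one>\<index>\<close>)
  cs_star :: "'a \<Rightarrow> 'a"

locale unital_cstar_algebra =
  fixes C :: "'a::complex_normed_vector star_structure" (structure)
  assumes subspace: "csubspace (cs_carrier C)"
    and complete: "complete (cs_carrier C)"
    and mult_closed: "\<lbrakk>x \<in> cs_carrier C; y \<in> cs_carrier C\<rbrakk> \<Longrightarrow> x \<otimes> y \<in> cs_carrier C"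
    and one_closed: "\<one> \<in> cs_carrier C"
    and star_closed: "x \<in> cs_carrier C \<Longrightarrow> cs_star C x \<in> cs_carrier C"
    and mult_assoc: "\<lbrakk>x \<in> cs_carrier C; y \<in> cs_carrier C; z \<in> cs_carrier C\<rbrakk>
          \<Longrightarrow> (x \<otimes> y) \<otimes> z = x \<otimes> (y \<otimes> z)"
    and mult_one: "x \<in> cs_carrier C \<Longrightarrow> x \<otimes> \<one> = x"
    and one_mult: "x \<in> cs_carrier C \<Longrightarrow> \<one> \<otimes> x = x"
    and mult_add_right: "\<lbrakk>x \<in> cs_carrier C; y \<in> cs_carrier C; z \<in> cs_carrier C\<rbrakk>
          \<Longrightarrow> x \<otimes> (y + z) = x \<otimes> y + x \<otimes> z"
    and mult_add_left: "\<lbrakk>x \<in> cs_carrier C; y \<in> cs_carrier C; z \<in> cs_carrier C\<rbrakk>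
          \<Longrightarrow> (x + y) \<otimes> z = x \<otimes> z + y \<otimes> z"
    and mult_scaleC_right: "\<lbrakk>x \<in> cs_carrier C; y \<in> cs_carrier C\<rbrakk>
          \<Longrightarrow> x \<otimes> (c *\<^sub>C y) = c *\<^sub>C (x \<otimes> y)"
    and mult_scaleC_left: "\<lbrakk>x \<in> cs_carrier C; y \<in> cs_carrier C\<rbrakk>
          \<Longrightarrow> (c *\<^sub>C x) \<otimes> y = c *\<^sub>C (x \<otimes> y)"
    and star_star: "x \<in> cs_carrier C \<Longrightarrow> cs_star C (cs_star C x) = x"
    and star_add: "\<lbrakk>x \<in> cs_carrier C; y \<in> cs_carrier C\<rbrakk>
          \<Longrightarrow> cs_star C (x + y) = cs_star C x + cs_star C y"
    and star_scaleC: "x \<in> cs_carrier C \<Longrightarrow> cs_star C (c *\<^sub>C x) = cnj c *\<^sub>C cs_star C x"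
    and star_mult: "\<lbrakk>x \<in> cs_carrier C; y \<in> cs_carrier C\<rbrakk>
          \<Longrightarrow> cs_star C (x \<otimes> y) = cs_star C y \<otimes> cs_star C x"
    and norm_mult_le: "\<lbrakk>x \<in> cs_carrier C; y \<in> cs_carrier C\<rbrakk>
          \<Longrightarrow> norm (x \<otimes> y) \<le> norm x * norm y"
    and cstar_identity: "x \<in> cs_carrier C \<Longrightarrow> norm (cs_star C x \<otimes> x) = (norm x)\<^sup>2"

definition clinear_on :: "'a::complex_vector set \<Rightarrow> ('a \<Rightarrow> 'b::complex_vector) \<Rightarrow> bool" where
  "clinear_on S f \<longleftrightarrow>
     (\<forall>x\<in>S. \<forall>y\<in>S. f (x + y) = f x + f y) \<and> (\<forall>c. \<forall>x\<in>S. f (c *\<^sub>C x) = c *\<^sub>C f x)"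

definition unital_star_hom ::
    "'a::complex_vector star_structure \<Rightarrow> 'b::complex_vector star_structure \<Rightarrow> ('a \<Rightarrow> 'b) \<Rightarrow> bool"
  where
  "unital_star_hom C D f \<longleftrightarrow>
     f ` cs_carrier C \<subseteq> cs_carrier D \<and> clinear_on (cs_carrier C) f \<and>
     (\<forall>x\<in>cs_carrier C. \<forall>y\<in>cs_carrier C. f (x \<otimes>\<^bsub>C\<^esub> y) = f x \<otimes>\<^bsub>D\<^esub> f y) \<and>
     (\<forall>x\<in>cs_carrier C. f (cs_star C x) = cs_star D (f x)) \<and> f \<one>\<^bsub>C\<^esub> = \<one>\<^bsub>D\<^esub>"

definition cstar_automorphism ::
    "'a::complex_normed_vector star_structure \<Rightarrow> ('a \<Rightarrow> 'a) \<Rightarrow> bool" where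
  "cstar_automorphism C \<alpha> \<longleftrightarrow>
     unital_cstar_algebra C \<and> unital_star_hom C C \<alpha> \<and> bij_betw \<alpha> (cs_carrier C) (cs_carrier C)"

definition operator_algebra :: "('a::chilbert_space \<Rightarrow>\<^sub>L 'a) set \<Rightarrow> ('a \<Rightarrow>\<^sub>L 'a) star_structure" where
  "operator_algebra M =
     \<lparr>cs_carrier = M, cs_mult = (o\<^sub>L), cs_one = id_blinfun, cs_star = adj\<rparr>"


section \<open>Normal unital completely positive maps and their minimal dilation\<close>

definition normal_on ::
    "('a::chilbert_space \<Rightarrow>\<^sub>L 'a) set \<Rightarrow> (('a \<Rightarrow>\<^sub>L 'a) \<Rightarrow> ('a \<Rightarrow>\<^sub>L 'a)) \<Rightarrow> bool" where
  "normal_on A \<tau> \<longleftrightarrow>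
     continuous_map (subtopology sigma_weak A) (subtopology sigma_weak A) \<tau>"

text \<open>Positivity of an \<open>n \<times> n\<close> operator matrix as an operator on $\mathcal H^n$.\<close>

definition positive_matrix :: "nat \<Rightarrow> (nat \<Rightarrow> nat \<Rightarrow> ('a::chilbert_space \<Rightarrow>\<^sub>L 'a)) \<Rightarrow> bool" where
  "positive_matrix n a \<longleftrightarrow>
     (\<forall>\<xi>. (\<Sum>i<n. \<Sum>j<n. cinner (\<xi> i) (blinfun_apply (a i j) (\<xi> j))) \<in> \<real>\<^sub>\<ge>\<^sub>0)"

definition completely_positive_on ::
    "('a::chilbert_space \<Rightarrow>\<^sub>L 'a) set \<Rightarrow> (('a \<Rightarrow>\<^sub>L 'a) \<Rightarrow> ('a \<Rightarrow>\<^sub>L 'a)) \<Rightarrow> bool" where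
  "completely_positive_on A \<tau> \<longleftrightarrow>
     (\<forall>n a. (\<forall>i<n. \<forall>j<n. a i j \<in> A) \<and> positive_matrix n a
        \<longrightarrow> positive_matrix n (\<lambda>i j. \<tau> (a i j)))"

definition normal_ucp_map ::
    "('a::chilbert_space \<Rightarrow>\<^sub>L 'a) set \<Rightarrow> (('a \<Rightarrow>\<^sub>L 'a) \<Rightarrow> ('a \<Rightarrow>\<^sub>L 'a)) \<Rightarrow> bool" where
  "normal_ucp_map A \<tau> \<longleftrightarrow>
     \<tau> ` A \<subseteq> A \<and> clinear_on A \<tau> \<and> completely_positive_on A \<tau> \<and> \<tau> id_blinfun = id_blinfun \<and>
     normal_on A \<tau>"

text \<open>The inclusion $\mathcal H \subseteq \mathcal K$ is given by a linear isometry \<open>V\<close>. Then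
  $p = VV^*$, an operator \<open>x\<close> on $\mathcal H$ is identified with $VxV^*$ on $\mathcal K$, and $pzp$,
  regarded as an operator on $\mathcal H$, is $V^*zV$.\<close>

definition isometric_embedding :: "('h::chilbert_space \<Rightarrow>\<^sub>L 'k::chilbert_space) \<Rightarrow> bool" where
  "isometric_embedding V \<longleftrightarrow> V \<in> bops \<and> (\<forall>h. norm (blinfun_apply V h) = norm h)"

definition range_proj :: "('h::chilbert_space \<Rightarrow>\<^sub>L 'k::chilbert_space) \<Rightarrow> ('k \<Rightarrow>\<^sub>L 'k)" where
  "range_proj V = V o\<^sub>L adj V"

definition embed_op ::
    "('h::chilbert_space \<Rightarrow>\<^sub>L 'k::chilbert_space) \<Rightarrow> ('h \<Rightarrow>\<^sub>L 'h) \<Rightarrow> ('k \<Rightarrow>\<^sub>L 'k)" where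
  "embed_op V x = V o\<^sub>L x o\<^sub>L adj V"

definition compress_op ::
    "('h::chilbert_space \<Rightarrow>\<^sub>L 'k::chilbert_space) \<Rightarrow> ('k \<Rightarrow>\<^sub>L 'k) \<Rightarrow> ('h \<Rightarrow>\<^sub>L 'h)" where
  "compress_op V z = adj V o\<^sub>L z o\<^sub>L V"

text \<open>$\theta^n(x_n)\cdots\theta(x_1)h$; the entry \<open>x 0\<close> is not used.\<close>

primrec dilation_vector ::
    "(('k::real_normed_vector \<Rightarrow>\<^sub>L 'k) \<Rightarrow> ('k \<Rightarrow>\<^sub>L 'k)) \<Rightarrow> (nat \<Rightarrow> ('k \<Rightarrow>\<^sub>L 'k)) \<Rightarrow> 'k \<Rightarrow> nat \<Rightarrow> 'k"
  where
  "dilation_vector \<theta> x h 0 = h"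
| "dilation_vector \<theta> x h (Suc n) =
     blinfun_apply ((\<theta> ^^ Suc n) (x (Suc n))) (dilation_vector \<theta> x h n)"

definition minimal_dilation ::
    "('h::chilbert_space \<Rightarrow>\<^sub>L 'h) set \<Rightarrow> (('h \<Rightarrow>\<^sub>L 'h) \<Rightarrow> ('h \<Rightarrow>\<^sub>L 'h)) \<Rightarrow>
     ('h \<Rightarrow>\<^sub>L 'k::chilbert_space) \<Rightarrow> ('k \<Rightarrow>\<^sub>L 'k) set \<Rightarrow> (('k \<Rightarrow>\<^sub>L 'k) \<Rightarrow> ('k \<Rightarrow>\<^sub>L 'k)) \<Rightarrow> bool" where
  "minimal_dilation A \<tau> V B \<theta> \<longleftrightarrow>
     isometric_embedding V \<and>
     von_neumann_algebra B \<and>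
     embed_op V ` A = (\<lambda>z. range_proj V o\<^sub>L z o\<^sub>L range_proj V) ` B \<and>
     unital_star_hom (operator_algebra B) (operator_algebra B) \<theta> \<and> normal_on B \<theta> \<and>
     (\<forall>x\<in>A. \<forall>n. embed_op V ((\<tau> ^^ n) x) =
        range_proj V o\<^sub>L (\<theta> ^^ n) (embed_op V x) o\<^sub>L range_proj V) \<and>
     closure (cspan {dilation_vector \<theta> x (blinfun_apply V h) n | x h n.
        \<forall>i. x i \<in> embed_op V ` A}) = UNIV \<and>
     B = generated_von_neumann_algebra {(\<theta> ^^ n) (embed_op V x) | n x. x \<in> A}"


section \<open>The peripheral Poisson boundary\<close>

definition peripheral_space ::
    "'a::complex_normed_vector set \<Rightarrow> ('a \<Rightarrow> 'a) \<Rightarrow> 'a set" where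
  "peripheral_space S \<alpha> = closure (cspan {x \<in> S. \<exists>c. cmod c = 1 \<and> \<alpha> x = c *\<^sub>C x})"

text \<open>The inverse of the compression $T : \mathcal P(\theta) \to \mathcal P(\tau)$.\<close>

definition peripheral_lift ::
    "('h::chilbert_space \<Rightarrow>\<^sub>L 'k::chilbert_space) \<Rightarrow> ('k \<Rightarrow>\<^sub>L 'k) set \<Rightarrow>
     (('k \<Rightarrow>\<^sub>L 'k) \<Rightarrow> ('k \<Rightarrow>\<^sub>L 'k)) \<Rightarrow> ('h \<Rightarrow>\<^sub>L 'h) \<Rightarrow> ('k \<Rightarrow>\<^sub>L 'k)" where
  "peripheral_lift V B \<theta> = the_inv_into (peripheral_space B \<theta>) (compress_op V)"

definition poisson_boundary ::
    "('h::chilbert_space \<Rightarrow>\<^sub>L 'h) set \<Rightarrow> (('h \<Rightarrow>\<^sub>L 'h) \<Rightarrow> ('h \<Rightarrow>\<^sub>L 'h)) \<Rightarrow>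
     ('h \<Rightarrow>\<^sub>L 'k::chilbert_space) \<Rightarrow> ('k \<Rightarrow>\<^sub>L 'k) set \<Rightarrow> (('k \<Rightarrow>\<^sub>L 'k) \<Rightarrow> ('k \<Rightarrow>\<^sub>L 'k)) \<Rightarrow>
     ('h \<Rightarrow>\<^sub>L 'h) star_structure" where
  "poisson_boundary A \<tau> V B \<theta> =
     \<lparr>cs_carrier = peripheral_space A \<tau>,
      cs_mult = (\<lambda>x y. compress_op V (peripheral_lift V B \<theta> x o\<^sub>L peripheral_lift V B \<theta> y)),
      cs_one = id_blinfun,
      cs_star = adj\<rparr>"

definition automorphism_boundary ::
    "'a::complex_normed_vector star_structure \<Rightarrow> ('a \<Rightarrow> 'a) \<Rightarrow> 'a star_structure" where
  "automorphism_boundary C \<alpha> = C\<lparr>cs_carrier := peripheral_space (cs_carrier C) \<alpha>\<rparr>"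

end

theory Submission
  imports Defs
begin

text \<open>
  The proof has two ingredients: a recurrence argument that makes every linear contraction
  bijective and isometric on its peripheral space, and the fact that compression to \<open>\<H>\<close> loses no
  peripheral information, which carries the algebra structure from \<open>\<theta>\<close> to \<open>\<tau>\<close>.

  Recurrence. On a finite linear combination of eigenvectors with unimodular eigenvalues a map \<open>\<alpha>\<close>
  acts by rotating finitely many coordinates, and finitely many rotations return simultaneously close
  to the identity: some power \<open>\<alpha>\<^sup>m\<close> with \<open>m \<ge> 1\<close> almost fixes the vector. If \<open>\<alpha>\<close> is a contraction, this
  recurrence passes to the norm closure (\<open>peripheral_recurrent\<close>). A contraction whose powers come back
  arbitrarily close to the identity cannot shrink any vector and has dense range, hence it is an
  isometric bijection of its peripheral space (\<open>peripheral_isometric\<close>, \<open>peripheral_bij\<close>). This applies to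
  \<open>\<theta>\<close>, because \<open>*\<close>-homomorphisms are contractive (\<open>star_hom_contractive\<close>), and to \<open>\<tau>\<close>, because
  \<open>\<tau>(x) = p\<theta>(x)p\<close>. So \<open>\<tau>\<close> is a bijection of \<open>\<P>(\<tau>)\<close> whatever the product is.

  Compression. The projections \<open>q\<^sub>n = \<theta>\<^sup>n(p)\<close> increase, since \<open>\<tau>\<close> is unital, and they converge strongly to
  the identity by minimality of the dilation (\<open>q_strong\<close>). An operator is therefore determined
  by its corners \<open>q\<^sub>n z q\<^sub>n\<close>. If \<open>z = \<theta>\<^sup>n(w)\<close>, such a corner is \<open>\<theta>\<^sup>n(pwp)\<close>; because
  \<open>\<theta>\<close> is bijective on \<open>\<P>(\<theta>)\<close> and \<open>\<tau>\<close> is isometric on \<open>\<P>(\<tau>)\<close>, its norm is at most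
  \<open>\<parallel>T w\<parallel> = \<parallel>\<tau>\<^sup>n(T w)\<parallel> = \<parallel>T z\<parallel>\<close>, so the compression \<open>T\<close> is isometric on \<open>\<P>(\<theta>)\<close> (\<open>T_isometric\<close>). Conversely,
  for \<open>\<tau>(x) = cx\<close> with \<open>|c| = 1\<close> the operators \<open>c\<^sup>-\<^sup>n\<theta>\<^sup>n(x)\<close> are the corners of one
  operator \<open>z\<close>, their strong limit, and \<open>z\<close> satisfies \<open>\<theta>(z) = cz\<close> and \<open>T z = x\<close> (\<open>eigenvector_lift\<close>). Hence \<open>T\<close> maps
  \<open>\<P>(\<theta>)\<close> isometrically onto \<open>\<P>(\<tau>)\<close> (\<open>T_bij\<close>), and \<open>\<P>(\<tau>)\<close> inherits the C*-algebra structure.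

  Finally \<open>T\<close> intertwines \<open>\<theta>\<close> and \<open>\<tau>\<close> (\<open>T_theta\<close>). So \<open>\<tau>\<close> on \<open>\<P>(\<tau>)\<close> is the transported \<open>\<theta>\<close>, which is
  multiplicative and \<open>*\<close>-preserving. All eigenvectors of \<open>\<tau>\<close> with unimodular eigenvalue already lie
  in \<open>\<P>(\<tau>)\<close>, so taking the boundary a second time changes nothing.
\<close>

section \<open>Adjoints of bounded operators\<close>

instance chilbert_space \<subseteq> banach ..

text \<open>The Riesz representation theorem by minimization: the representing vector is the minimizer of
  \<open>\<parallel>u\<parallel>\<^sup>2 - 2 f(u)\<close>. The parallelogram law makes minimizing sequences Cauchy, and the vanishing of
  the first variation at the minimizer is the representation.\<close>

lemma riesz_representation:
  fixes f :: "'a::{real_inner,complete_space} \<Rightarrow> real"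
  assumes f: "bounded_linear f"
  obtains w where "\<And>u. f u = u \<bullet> w"
proof -
  interpret f: bounded_linear f by (rule f)
  define F where "F u = (norm u)\<^sup>2 - 2 * f u" for u
  obtain K where K: "\<And>u. \<bar>f u\<bar> \<le> norm u * K" using f.bounded by auto
  have low: "- K\<^sup>2 \<le> F u" for u
  proof -
    have "0 \<le> (norm u - K)\<^sup>2" by simp
    then show ?thesis using K[of u] by (simp add: F_def power2_diff)
  qed
  define m where "m = Inf (range F)"
  have bdd: "bdd_below (range F)" using low by (auto simp: bdd_below_def)
  have m_le: "m \<le> F u" for u unfolding m_def by (rule cInf_lower[OF _ bdd]) auto
  have "\<exists>u. F u < m + 1 / Suc n" for n
  proof -
    have "Inf (range F) < m + 1 / Suc n" by (simp add: m_def)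
    from cInf_lessD[OF _ this] show ?thesis by auto
  qed
  then obtain s where s: "\<And>n. F (s n) < m + 1 / Suc n" by metis
  have par: "(norm (u - v))\<^sup>2 \<le> 2 * F u + 2 * F v - 4 * m" for u v
  proof -
    have "(norm (u - v))\<^sup>2 = 2 * F u + 2 * F v - 4 * F ((1/2) *\<^sub>R (u + v))"
      by (simp add: F_def f.scaleR f.add power2_norm_eq_inner inner_simps inner_commute algebra_simps)
    then show ?thesis using m_le[of "(1/2) *\<^sub>R (u + v)"] by linarith
  qed
  have "Cauchy s"
  proof (rule metric_CauchyI)
    fix e :: real assume e: "e > 0"
    obtain N where N: "4 / e\<^sup>2 < real N" using reals_Archimedean2 by blast
    have "N > 0" using N e by (cases N) (auto simp: not_less field_simps)
    have "dist (s i) (s j) < e" if "i \<ge> N" "j \<ge> N" for i j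
    proof -
      have a: "1 / Suc i \<le> 1 / N" "1 / Suc j \<le> 1 / N" using that \<open>N > 0\<close> by (auto simp: field_simps)
      have "(norm (s i - s j))\<^sup>2 < 4 / N" using par[of "s i" "s j"] s[of i] s[of j] a by auto
      also have "\<dots> < e\<^sup>2" using N e \<open>N > 0\<close> by (simp add: field_simps)
      finally show ?thesis using e by (simp add: dist_norm power2_less_imp_less)
    qed
    then show "\<exists>M. \<forall>i\<ge>M. \<forall>j\<ge>M. dist (s i) (s j) < e" by blast
  qed
  then obtain w where w: "s \<longlonglongrightarrow> w" using Cauchy_convergent convergent_def by blast
  have "(\<lambda>n. F (s n)) \<longlonglongrightarrow> F w"
    unfolding F_def by (intro tendsto_intros w f.tendsto)
  moreover have "(\<lambda>n. m + 1 / Suc n) \<longlonglongrightarrow> m + 0"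
    by (intro tendsto_intros LIMSEQ_Suc[OF lim_1_over_n])
  ultimately have "F w \<le> m + 0"
    by (rule LIMSEQ_le) (use s less_imp_le in blast)
  then have Fw: "F w \<le> m" by simp
  have "f u = u \<bullet> w" for u
  proof -
    define b where "b = u \<bullet> w - f u"
    have q: "0 \<le> t\<^sup>2 * (norm u)\<^sup>2 + 2 * t * b" for t
    proof -
      have "(norm (w + t *\<^sub>R u))\<^sup>2 = (norm w)\<^sup>2 + 2 * t * (u \<bullet> w) + t\<^sup>2 * (norm u)\<^sup>2"
        unfolding power2_norm_eq_inner
        by (simp add: inner_simps inner_commute power2_eq_square algebra_simps)
      moreover have "F w \<le> F (w + t *\<^sub>R u)" using Fw m_le order_trans by blast
      ultimately show ?thesis
        by (simp add: F_def b_def f.scaleR f.add algebra_simps)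
    qed
    have "b = 0"
    proof (rule ccontr)
      assume "b \<noteq> 0"
      define c where "c = (norm u)\<^sup>2 + 1"
      have c: "c > 0" by (simp add: c_def add_nonneg_pos)
      \<comment> \<open>A small step against the sign of \<open>b\<close> would lower \<open>F\<close>; the coefficient \<open>- b / c\<close> works also for \<open>u = 0\<close>.\<close>
      have "0 \<le> (- b / c)\<^sup>2 * (c - 1) + 2 * (- b / c) * b" using q[of "- b / c"] by (simp add: c_def)
      also have "\<dots> = - (b\<^sup>2 / c) - b\<^sup>2 / c\<^sup>2"
        using c by (simp add: field_simps power2_eq_square)
      also have "\<dots> < 0" using c \<open>b \<noteq> 0\<close> by (smt (verit) divide_pos_pos zero_less_power2)
      finally show False by simp
    qed
    then show ?thesis by (simp add: b_def)
  qed
  then show thesis using that by blast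
qed

text \<open>Expressing the complex inner product through the real one makes the continuity
  of the latter available.\<close>

lemma cinner_via_inner: "cinner x y = Complex (x \<bullet> y) (x \<bullet> ((- \<i>) *\<^sub>C y))"
  using cinner_scaleC_right[of x "- \<i>" y] Re_cinner[of x "(- \<i>) *\<^sub>C y"]
  by (simp add: complex_eq_iff Re_cinner)

lemma tendsto_cinner_right: "(f \<longlongrightarrow> l) F \<Longrightarrow> ((\<lambda>n. cinner x (f n)) \<longlongrightarrow> cinner x l) F"
  unfolding cinner_via_inner
  by (intro tendsto_intros bounded_linear.tendsto[OF bounded_linear_scaleC])

lemma cinner_eqI: "(\<And>u. cinner u v = cinner u w) \<Longrightarrow> v = w"
  by (metis Re_cinner vector_eq_ldot)

lemma cinner_add_left: "cinner (x + y) z = cinner x z + cinner y z"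
  by (metis cinner_add_right cinner_commute complex_cnj_add)

lemma bops_scaleC: "x \<in> bops \<Longrightarrow> x (c *\<^sub>C v) = c *\<^sub>C x v"
  by (simp add: bops_def)

text \<open>The real Riesz theorem suffices: a real adjoint of a complex-linear operator respects the
  complex inner product, because the imaginary part of \<open>\<langle>xu, v\<rangle>\<close> is the real part of \<open>\<langle>x(iu), v\<rangle>\<close>.\<close>

lemma ex_adjoint:
  fixes x :: "'a::chilbert_space \<Rightarrow>\<^sub>L 'b::chilbert_space"
  assumes "x \<in> bops"
  shows "\<exists>y. \<forall>u v. cinner (x u) v = cinner u (blinfun_apply y v)"
proof -
  have "\<exists>w. \<forall>u. x u \<bullet> v = u \<bullet> w" for v
    by (rule riesz_representation[of "\<lambda>u. x u \<bullet> v"])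
      (auto intro!: bounded_linear_intros)
  then obtain g where g: "\<And>u v. x u \<bullet> v = u \<bullet> g v" by metis
  have "bounded_linear g"
  proof (rule bounded_linear_intro[where K = "norm x"])
    show "g (u + v) = g u + g v" for u v
      by (rule vector_eq_ldot[THEN iffD1]) (simp add: inner_simps flip: g)
    show "g (r *\<^sub>R v) = r *\<^sub>R g v" for r v
      by (rule vector_eq_ldot[THEN iffD1]) (simp add: inner_simps flip: g)
    show "norm (g v) \<le> norm v * norm x" for v
    proof (cases "g v = 0")
      case False
      have "norm (g v) * norm (g v) = x (g v) \<bullet> v"
        by (simp add: g power2_norm_eq_inner[symmetric] power2_eq_square)
      also have "\<dots> \<le> norm (x (g v)) * norm v" by (rule norm_cauchy_schwarz)
      also have "\<dots> \<le> norm x * norm (g v) * norm v" by (intro mult_right_mono norm_blinfun) simp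
      finally show ?thesis using False by (simp add: mult.commute mult.left_commute)
    qed simp
  qed
  moreover have "cinner (x u) v = cinner u (g v)" for u v
  proof -
    have "Im (cinner (x u) v) = Re (cinner (x (\<i> *\<^sub>C u)) v)"
      by (simp add: bops_scaleC[OF assms] cinner_scaleC_left)
    also have "\<dots> = Re (cinner (\<i> *\<^sub>C u) (g v))" by (simp only: Re_cinner g)
    finally show ?thesis by (simp add: complex_eq_iff Re_cinner g cinner_scaleC_left)
  qed
  ultimately show ?thesis
    by (intro exI[of _ "Blinfun g"]) (simp add: bounded_linear_Blinfun_apply)
qed

lemma adj_eqI:
  assumes "\<And>u v. cinner (blinfun_apply x u) v = cinner u (blinfun_apply y v)"
  shows "adj x = y"
  unfolding adj_def
proof (rule the_equality)
  fix y' assume "\<forall>u v. cinner (x u) v = cinner u (blinfun_apply y' v)"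
  then have "cinner u (y' v) = cinner u (y v)" for u v
    using assms[of u v] by simp
  then have "y' v = y v" for v by (rule cinner_eqI)
  then show "y' = y" by (intro blinfun_eqI)
qed (use assms in blast)

lemma cinner_adj: "x \<in> bops \<Longrightarrow> cinner (x u) v = cinner u (adj x v)"
proof -
  assume "x \<in> bops"
  then obtain y where y: "\<And>u v. cinner (x u) v = cinner u (blinfun_apply y v)"
    using ex_adjoint by blast
  then have "adj x = y" by (rule adj_eqI)
  with y show ?thesis by simp
qed

lemma inner_adj: "x \<in> bops \<Longrightarrow> x u \<bullet> v = u \<bullet> adj x v"
  by (metis Re_cinner cinner_adj)

lemma csubspace_bops: "csubspace bops"
  by (auto simp: complex_vector.subspace_def bops_def blinfun.bilinear_simps scaleC_add_right
      scaleC_blinfun.rep_eq scaleC_scaleC mult.commute)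

lemma compose_scaleC_left: "(c *\<^sub>C x) o\<^sub>L y = c *\<^sub>C (x o\<^sub>L y)"
  by (rule blinfun_eqI) (simp add: scaleC_blinfun.rep_eq)

lemma compose_scaleC_right: "x \<in> bops \<Longrightarrow> x o\<^sub>L (c *\<^sub>C y) = c *\<^sub>C (x o\<^sub>L y)"
  by (rule blinfun_eqI) (simp add: scaleC_blinfun.rep_eq bops_scaleC)

lemma id_in_bops: "id_blinfun \<in> bops"
  by (simp add: bops_def)

lemma adj_in_bops:
  assumes "x \<in> bops" shows "adj x \<in> bops"
proof -
  have "adj x (c *\<^sub>C v) = c *\<^sub>C adj x v" for c v
    by (rule cinner_eqI) (simp add: cinner_scaleC_right flip: cinner_adj[OF assms])
  then show ?thesis by (simp add: bops_def)
qed

lemma adj_adj: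
  assumes "x \<in> bops" shows "adj (adj x) = x"
proof (rule adj_eqI)
  fix u v show "cinner (adj x u) v = cinner u (x v)"
    using cinner_adj[OF assms, of v u] cinner_commute[of "adj x u" v] cinner_commute[of u "x v"] by simp
qed

lemma cinner_adj_left: "x \<in> bops \<Longrightarrow> cinner (adj x u) v = cinner u (x v)"
  by (simp add: cinner_adj adj_in_bops adj_adj)

lemma adj_add: "x \<in> bops \<Longrightarrow> y \<in> bops \<Longrightarrow> adj (x + y) = adj x + adj y"
  by (rule adj_eqI) (simp add: blinfun.add_left cinner_add_left cinner_add_right cinner_adj)

lemma adj_scaleC: "x \<in> bops \<Longrightarrow> adj (c *\<^sub>C x) = cnj c *\<^sub>C adj x"
  by (rule adj_eqI) (simp add: scaleC_blinfun.rep_eq cinner_scaleC_left cinner_scaleC_right cinner_adj)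

lemma adj_compose: "x \<in> bops \<Longrightarrow> y \<in> bops \<Longrightarrow> adj (x o\<^sub>L y) = adj y o\<^sub>L adj x"
  by (rule adj_eqI) (simp add: cinner_adj)

lemma norm_adj:
  assumes "x \<in> bops" shows "norm (adj x) = norm x"
proof -
  have "norm (adj y) \<le> norm y" if y: "y \<in> bops" for y :: "'c::chilbert_space \<Rightarrow>\<^sub>L 'd::chilbert_space"
  proof (rule norm_blinfun_bound)
    fix v
    have "norm (adj y v) * norm (adj y v) = y (adj y v) \<bullet> v"
      by (simp add: inner_adj[OF y] power2_norm_eq_inner[symmetric] power2_eq_square)
    also have "\<dots> \<le> norm (y (adj y v)) * norm v" by (rule norm_cauchy_schwarz)
    also have "\<dots> \<le> norm y * norm (adj y v) * norm v" by (intro mult_right_mono norm_blinfun) simp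
    finally show "norm (adj y v) \<le> norm y * norm v"
      by (cases "adj y v = 0") (auto simp: mult.commute mult.left_commute)
  qed simp
  from this[OF assms] this[OF adj_in_bops[OF assms]] show ?thesis
    by (simp add: adj_adj assms)
qed

lemma norm_adj_compose_self:
  assumes x: "x \<in> bops" shows "norm (adj x o\<^sub>L x) = (norm x)\<^sup>2"
proof (rule antisym)
  show "norm (adj x o\<^sub>L x) \<le> (norm x)\<^sup>2"
    using norm_blinfun_compose[of "adj x" x] by (simp add: norm_adj x power2_eq_square)
  have "norm x \<le> sqrt (norm (adj x o\<^sub>L x))"
  proof (rule norm_blinfun_bound)
    fix u
    have "(norm (x u))\<^sup>2 = u \<bullet> (adj x o\<^sub>L x) u"
      by (simp add: power2_norm_eq_inner inner_adj[OF x])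
    also have "\<dots> \<le> norm u * norm ((adj x o\<^sub>L x) u)" by (rule norm_cauchy_schwarz)
    also have "\<dots> \<le> norm u * (norm (adj x o\<^sub>L x) * norm u)"
      by (intro mult_left_mono norm_blinfun) simp
    also have "\<dots> = (sqrt (norm (adj x o\<^sub>L x)) * norm u)\<^sup>2"
      unfolding power_mult_distrib by (simp add: power2_eq_square)
    finally show "norm (x u) \<le> sqrt (norm (adj x o\<^sub>L x)) * norm u"
      by (rule power2_le_imp_le) simp
  qed simp
  then have "(norm x)\<^sup>2 \<le> (sqrt (norm (adj x o\<^sub>L x)))\<^sup>2" by (rule power_mono) simp
  then show "(norm x)\<^sup>2 \<le> norm (adj x o\<^sub>L x)" by simp
qed

section \<open>Peripheral spaces of linear contractions\<close>

lemma csubspace_closure: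
  fixes S :: "'a::complex_normed_vector set"
  assumes S: "csubspace S"
  shows "csubspace (closure S)"
  unfolding complex_vector.subspace_def
proof (intro conjI ballI allI)
  show "0 \<in> closure S"
    using complex_vector.subspace_0[OF S] closure_subset by blast
next
  fix x y assume "x \<in> closure S" "y \<in> closure S"
  then obtain f g where f: "\<And>n. f n \<in> S" "f \<longlonglongrightarrow> x" and g: "\<And>n. g n \<in> S" "g \<longlonglongrightarrow> y"
    unfolding closure_sequential by blast
  have "(\<lambda>n. f n + g n) \<longlonglongrightarrow> x + y" by (intro tendsto_intros f g)
  moreover have "\<forall>n. f n + g n \<in> S" by (simp add: complex_vector.subspace_add[OF S] f g)
  ultimately show "x + y \<in> closure S"
    unfolding closure_sequential by (intro exI[of _ "\<lambda>n. f n + g n"] conjI)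
next
  fix c x assume "x \<in> closure S"
  then obtain f where f: "\<And>n. f n \<in> S" "f \<longlonglongrightarrow> x" unfolding closure_sequential by blast
  have "(\<lambda>n. c *\<^sub>C f n) \<longlonglongrightarrow> c *\<^sub>C x"
    by (intro bounded_linear.tendsto[OF bounded_linear_scaleC] f)
  moreover have "\<forall>n. c *\<^sub>C f n \<in> S" by (simp add: complex_vector.subspace_scale[OF S] f)
  ultimately show "c *\<^sub>C x \<in> closure S"
    unfolding closure_sequential by (intro exI[of _ "\<lambda>n. c *\<^sub>C f n"] conjI)
qed

lemma csubspace_peripheral_space: "csubspace (peripheral_space S \<alpha>)"
  unfolding peripheral_space_def
  by (intro csubspace_closure complex_vector.subspace_span)

lemma closed_peripheral_space: "closed (peripheral_space S \<alpha>)"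
  by (simp add: peripheral_space_def)

lemma eigenvector_in_peripheral_space:
  "\<lbrakk>x \<in> S; cmod c = 1; \<alpha> x = c *\<^sub>C x\<rbrakk> \<Longrightarrow> x \<in> peripheral_space S \<alpha>"
  unfolding peripheral_space_def
  by (rule subsetD[OF closure_subset], rule complex_vector.span_base) blast

text \<open>The induction principle for peripheral spaces: properties that define closed
  subspaces need only be checked on eigenvectors.\<close>

lemma peripheral_space_minimal:
  assumes "csubspace M" "closed M"
    and "\<And>x c. \<lbrakk>x \<in> S; cmod c = 1; \<alpha> x = c *\<^sub>C x\<rbrakk> \<Longrightarrow> x \<in> M"
  shows "peripheral_space S \<alpha> \<subseteq> M"
  unfolding peripheral_space_def using assms
  by (intro closure_minimal complex_vector.span_minimal) auto

text \<open>Along a common subsequence all the power sequences converge, by compactness of the circle. Quotients of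
  consecutive terms of the subsequence are then powers close to \<open>1\<close>.\<close>

lemma unimodular_simultaneous_recurrence:
  assumes "finite F" "\<And>c. c \<in> F \<Longrightarrow> cmod c = 1" "e > 0"
  obtains m where "m \<ge> 1" "\<And>c. c \<in> F \<Longrightarrow> cmod (c ^ m - 1) < e"
proof -
  have "\<exists>r :: nat \<Rightarrow> nat. strict_mono r \<and> (\<forall>c\<in>F. convergent (\<lambda>k. c ^ r k))"
    using assms(1,2)
  proof (induction F rule: finite_induct)
    case empty
    then show ?case by (intro exI[of _ id]) (simp add: strict_mono_def)
  next
    case (insert c F)
    then obtain r :: "nat \<Rightarrow> nat" where r: "strict_mono r" "\<forall>c\<in>F. convergent (\<lambda>k. c ^ r k)"
      by auto
    have "\<forall>k. c ^ r k \<in> sphere 0 1" using insert.prems by (simp add: norm_power)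
    then obtain l s where s: "strict_mono s" "((\<lambda>k. c ^ r k) \<circ> s) \<longlonglongrightarrow> l"
      using compact_sphere[of "0 :: complex" 1] unfolding compact_def by meson
    have "convergent (\<lambda>k. d ^ r (s k))" if d: "d \<in> F" for d
      using convergent_subseq_convergent[OF bspec[OF r(2) d] s(1)] by (simp add: o_def)
    moreover have "convergent (\<lambda>k. c ^ r (s k))" using s(2) by (auto simp: convergent_def o_def)
    ultimately show ?case
      using strict_mono_o[OF r(1) s(1)] by (intro exI[of _ "r \<circ> s"]) (auto simp: o_def)
  qed
  then obtain r :: "nat \<Rightarrow> nat" where r: "strict_mono r" "\<And>c. c \<in> F \<Longrightarrow> convergent (\<lambda>k. c ^ r k)"
    by blast
  have "\<forall>\<^sub>F k in sequentially. dist (c ^ r (Suc k)) (c ^ r k) < e" if c: "c \<in> F" for c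
  proof -
    obtain l where l: "(\<lambda>k. c ^ r k) \<longlonglongrightarrow> l" using r(2)[OF c] by (auto simp: convergent_def)
    have "(\<lambda>k. dist (c ^ r (Suc k)) (c ^ r k)) \<longlonglongrightarrow> dist l l"
      by (intro tendsto_dist l LIMSEQ_Suc[OF l])
    then show ?thesis using \<open>e > 0\<close> by (auto dest: order_tendstoD(2))
  qed
  then have "\<forall>\<^sub>F k in sequentially. \<forall>c\<in>F. dist (c ^ r (Suc k)) (c ^ r k) < e"
    by (intro eventually_ball_finite assms(1)) blast
  then obtain k where k: "\<And>c. c \<in> F \<Longrightarrow> dist (c ^ r (Suc k)) (c ^ r k) < e"
    by (auto simp: eventually_sequentially)
  define m where "m = r (Suc k) - r k"
  have "r k < r (Suc k)" using r(1) by (simp add: strict_mono_def)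
  then have m: "m \<ge> 1" "r (Suc k) = r k + m" by (auto simp: m_def)
  have "cmod (c ^ m - 1) < e" if c: "c \<in> F" for c
  proof -
    have "c ^ r (Suc k) - c ^ r k = c ^ r k * (c ^ m - 1)"
      by (simp add: m(2) power_add algebra_simps)
    then show ?thesis
      using k[OF c] assms(2)[OF c] by (simp add: dist_norm norm_mult norm_power)
  qed
  with m(1) show thesis by (rule that)
qed

text \<open>Completeness of isometric images, for maps that are only controlled on the
  given set: linear contractions of a subspace carry no information outside it.\<close>

lemma complete_isometric_image_on:
  assumes S: "complete S" and f: "\<And>x y. \<lbrakk>x \<in> S; y \<in> S\<rbrakk> \<Longrightarrow> dist (f x) (f y) = dist x y"
  shows "complete (f ` S)"
  unfolding complete_def
proof (intro allI impI, elim conjE)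
  fix s assume "\<forall>n. s n \<in> f ` S" and s: "Cauchy s"
  then obtain u where u: "\<And>n. u n \<in> S" "\<And>n. s n = f (u n)" unfolding image_iff by metis
  have "Cauchy u" using s unfolding Cauchy_def by (simp add: f u)
  then obtain l where l: "l \<in> S" "u \<longlonglongrightarrow> l" using S u(1) unfolding complete_def by blast
  have "s \<longlonglongrightarrow> f l"
    using l(2) unfolding tendsto_dist_iff[of s] tendsto_dist_iff[of u] by (simp add: u f l(1))
  with l(1) show "\<exists>l\<in>f ` S. s \<longlonglongrightarrow> l" by blast
qed

locale linear_contraction =
  fixes S :: "'a::complex_normed_vector set" and \<alpha> :: "'a \<Rightarrow> 'a"
  assumes subspace: "csubspace S" and complete: "complete S"
    and maps: "\<alpha> ` S \<subseteq> S" and linear: "clinear_on S \<alpha>"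
    and contractive: "x \<in> S \<Longrightarrow> norm (\<alpha> x) \<le> norm x"
begin

lemma in_S: "x \<in> S \<Longrightarrow> \<alpha> x \<in> S"
  using maps by blast

lemma diff:
  assumes "x \<in> S" "y \<in> S" shows "\<alpha> (x - y) = \<alpha> x - \<alpha> y"
proof -
  have "\<alpha> (x + (- 1) *\<^sub>C y) = \<alpha> x + (- 1) *\<^sub>C \<alpha> y"
    using linear assms complex_vector.subspace_scale[OF subspace assms(2)]
    unfolding clinear_on_def by presburger
  then show ?thesis by (simp add: scaleC_one)
qed

lemma scale: "x \<in> S \<Longrightarrow> \<alpha> (c *\<^sub>C x) = c *\<^sub>C \<alpha> x"
  using linear unfolding clinear_on_def by blast

lemma sum: "finite I \<Longrightarrow> (\<And>i. i \<in> I \<Longrightarrow> g i \<in> S) \<Longrightarrow> \<alpha> (\<Sum>i\<in>I. g i) = (\<Sum>i\<in>I. \<alpha> (g i))"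
proof (induction I rule: finite_induct)
  case empty
  show ?case using diff[of 0 0] complex_vector.subspace_0[OF subspace] by simp
next
  case (insert i I)
  have "sum g I \<in> S" by (rule complex_vector.subspace_sum[OF subspace]) (use insert in blast)
  with insert show ?case using linear by (simp add: clinear_on_def)
qed

lemma iterate: "linear_contraction S (\<alpha> ^^ n)"
proof (induction n)
  case 0
  show ?case using subspace complete by unfold_locales (auto simp: clinear_on_def)
next
  case (Suc n)
  interpret n: linear_contraction S "\<alpha> ^^ n" by (rule Suc)
  show ?case
  proof
    show "clinear_on S (\<alpha> ^^ Suc n)"
      using n.linear linear n.in_S unfolding clinear_on_def by simp
    show "norm ((\<alpha> ^^ Suc n) x) \<le> norm x" if "x \<in> S" for x
      using contractive[OF n.in_S[OF that]] n.contractive[OF that] by simp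
  qed (use subspace complete in_S n.in_S in auto)
qed

lemma peripheral_subset: "peripheral_space S \<alpha> \<subseteq> S"
  by (rule peripheral_space_minimal[OF subspace complete_imp_closed[OF complete]])

lemma peripheral_maps:
  assumes "x \<in> peripheral_space S \<alpha>" shows "\<alpha> x \<in> peripheral_space S \<alpha>"
proof -
  let ?P = "peripheral_space S \<alpha>"
  have "continuous_on S \<alpha>"
  proof (rule continuous_onI)
    fix x e assume x: "x \<in> S" and e: "0 < (e::real)"
    have "dist (\<alpha> y) (\<alpha> x) \<le> e" if "y \<in> S" "dist y x < e" for y
      using contractive[of "y - x"] that x complex_vector.subspace_diff[OF subspace]
      by (simp add: dist_norm flip: diff)
    with e show "\<exists>d>0. \<forall>y\<in>S. dist y x < d \<longrightarrow> dist (\<alpha> y) (\<alpha> x) \<le> e" by blast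
  qed
  then have "closed (S \<inter> \<alpha> -` ?P)"
    using complete_imp_closed[OF complete] closed_peripheral_space
    by (rule continuous_closed_preimage)
  moreover have "csubspace (S \<inter> \<alpha> -` ?P)"
    unfolding complex_vector.subspace_def
    using subspace csubspace_peripheral_space[of S \<alpha>] linear diff[of 0 0]
    by (auto simp: clinear_on_def complex_vector.subspace_def)
  ultimately have "?P \<subseteq> S \<inter> \<alpha> -` ?P"
    by (intro peripheral_space_minimal)
      (auto simp: eigenvector_in_peripheral_space complex_vector.subspace_scale[OF csubspace_peripheral_space])
  with assms show ?thesis by blast
qed

text \<open>Linear combinations of eigenvectors recur by simultaneous recurrence of
  their eigenvalues. Since all powers of \<open>\<alpha>\<close> are contractions, an approximation error does not grow along
  the orbit, so limits of such combinations recur as well.\<close>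

lemma peripheral_recurrent:
  assumes x: "x \<in> peripheral_space S \<alpha>" and e: "e > 0"
  obtains m where "m \<ge> 1" "dist ((\<alpha> ^^ m) x) x < e"
proof -
  let ?E = "{x \<in> S. \<exists>c. cmod c = 1 \<and> \<alpha> x = c *\<^sub>C x}"
  obtain y where y: "y \<in> cspan ?E" "dist y x < e / 3"
    using x divide_pos_pos[OF e zero_less_numeral[of "num.Bit1 num.One"]]
    unfolding peripheral_space_def closure_approachable by blast
  then obtain t r where t: "finite t" "t \<subseteq> ?E" and y_eq: "y = (\<Sum>a\<in>t. r a *\<^sub>C a)"
    unfolding complex_vector.span_explicit by blast
  have "\<forall>a\<in>t. \<exists>c. cmod c = 1 \<and> \<alpha> a = c *\<^sub>C a" using t(2) by blast
  then obtain c where c: "\<And>a. a \<in> t \<Longrightarrow> cmod (c a) = 1" "\<And>a. a \<in> t \<Longrightarrow> \<alpha> a = c a *\<^sub>C a"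
    by metis
  have tS: "a \<in> S" if "a \<in> t" for a using t(2) that by blast
  \<comment> \<open>The summand \<open>1\<close> makes \<open>K\<close> positive and the final estimate strict.\<close>
  define K where "K = (\<Sum>a\<in>t. norm (r a *\<^sub>C a)) + 1"
  have K: "K > 0" unfolding K_def by (intro add_nonneg_pos sum_nonneg) auto
  obtain m where m: "m \<ge> 1" "\<And>z. z \<in> c ` t \<Longrightarrow> cmod (z ^ m - 1) < e / 3 / K"
    using unimodular_simultaneous_recurrence[of "c ` t" "e / 3 / K"] t(1) c(1) e K by auto
  interpret m: linear_contraction S "\<alpha> ^^ m" by (rule iterate)
  have pow: "(\<alpha> ^^ m) a = c a ^ m *\<^sub>C a" if a: "a \<in> t" for a
    by (induction m) (simp_all add: scaleC_one scale tS[OF a] c(2)[OF a] scaleC_scaleC mult.commute)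
  have "(\<alpha> ^^ m) y = (\<Sum>a\<in>t. r a *\<^sub>C c a ^ m *\<^sub>C a)"
    unfolding y_eq using t(1) tS
    by (simp add: m.sum m.scale pow complex_vector.subspace_scale[OF subspace])
  then have "(\<alpha> ^^ m) y - y = (\<Sum>a\<in>t. (c a ^ m - 1) *\<^sub>C r a *\<^sub>C a)"
    by (simp add: y_eq sum_subtractf scaleC_scaleC complex_vector.scale_left_diff_distrib
        left_diff_distrib mult.commute[of "r _"])
  also have "norm \<dots> \<le> (\<Sum>a\<in>t. e / 3 / K * norm (r a *\<^sub>C a))"
  proof (rule sum_norm_le)
    fix a assume "a \<in> t"
    then have "cmod (c a ^ m - 1) \<le> e / 3 / K" using m(2) by (intro less_imp_le) blast
    then show "norm ((c a ^ m - 1) *\<^sub>C r a *\<^sub>C a) \<le> e / 3 / K * norm (r a *\<^sub>C a)"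
      unfolding norm_scaleC[of "_ - _"] by (rule mult_right_mono) simp
  qed
  also have "\<dots> = e / 3 / K * (K - 1)" by (simp add: K_def sum_distrib_left)
  also have "\<dots> < e / 3" using K e by (simp add: field_simps)
  finally have "dist ((\<alpha> ^^ m) y) y < e / 3" by (simp add: dist_norm)
  moreover have "dist ((\<alpha> ^^ m) x) ((\<alpha> ^^ m) y) \<le> dist x y"
  proof -
    have "x \<in> S" using x peripheral_subset by blast
    moreover have "y \<in> S" unfolding y_eq
      by (intro complex_vector.subspace_sum[OF subspace] complex_vector.subspace_scale[OF subspace] tS)
    ultimately show ?thesis
      using m.contractive[of "x - y"] m.diff[of x y] complex_vector.subspace_diff[OF subspace]
      by (simp add: dist_norm)
  qed
  ultimately have "dist ((\<alpha> ^^ m) x) x < e"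
    using y(2) dist_triangle[of "(\<alpha> ^^ m) x" x "(\<alpha> ^^ m) y"] dist_triangle[of "(\<alpha> ^^ m) y" x y]
    by (simp add: dist_commute[of x y])
  with m(1) show thesis by (rule that)
qed

text \<open>The norms along an orbit do not increase, yet the orbit comes back arbitrarily close to its starting point;
  so nothing is lost in the first step.\<close>

lemma peripheral_isometric:
  assumes x: "x \<in> peripheral_space S \<alpha>" shows "norm (\<alpha> x) = norm x"
proof (rule antisym)
  have xS: "x \<in> S" using x peripheral_subset by blast
  show "norm (\<alpha> x) \<le> norm x" by (rule contractive[OF xS])
  show "norm x \<le> norm (\<alpha> x)"
  proof (rule field_le_epsilon)
    fix e :: real assume "e > 0"
    then obtain m where m: "m \<ge> 1" "dist ((\<alpha> ^^ m) x) x < e" by (rule peripheral_recurrent[OF x])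
    obtain k where k: "m = Suc k" using m(1) by (cases m) auto
    have "norm ((\<alpha> ^^ m) x) \<le> norm (\<alpha> x)"
      using linear_contraction.contractive[OF iterate in_S[OF xS], of k]
      by (simp add: k funpow_swap1)
    then show "norm x \<le> norm (\<alpha> x) + e"
      using m(2) norm_triangle_sub[of x "(\<alpha> ^^ m) x"] by (simp add: dist_norm norm_minus_commute)
  qed
qed

lemma peripheral_dist:
  assumes "x \<in> peripheral_space S \<alpha>" "y \<in> peripheral_space S \<alpha>"
  shows "dist (\<alpha> x) (\<alpha> y) = dist x y"
  using peripheral_isometric[of "x - y"] assms peripheral_subset
    complex_vector.subspace_diff[OF csubspace_peripheral_space, of x S \<alpha> y]
  by (auto simp: dist_norm diff subset_iff)

lemma peripheral_complete: "complete (peripheral_space S \<alpha>)"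
  using complete_closed_subset[OF closed_peripheral_space peripheral_subset complete] .

text \<open>By recurrence every peripheral vector is a limit of points \<open>\<alpha>\<^sup>m(x)\<close> with \<open>m \<ge> 1\<close> of
  the range, and the range is closed because \<open>\<alpha>\<close> is isometric.\<close>

lemma peripheral_bij: "bij_betw \<alpha> (peripheral_space S \<alpha>) (peripheral_space S \<alpha>)"
proof -
  let ?P = "peripheral_space S \<alpha>"
  have "inj_on \<alpha> ?P" by (rule inj_onI) (metis dist_eq_0_iff peripheral_dist)
  moreover have "?P \<subseteq> \<alpha> ` ?P"
  proof
    fix x assume x: "x \<in> ?P"
    have iter: "(\<alpha> ^^ n) x \<in> ?P" for n by (induction n) (auto simp: x peripheral_maps)
    have "\<exists>y\<in>\<alpha> ` ?P. dist y x < e" if "e > 0" for e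
    proof -
      obtain m where m: "m \<ge> 1" "dist ((\<alpha> ^^ m) x) x < e" using peripheral_recurrent[OF x \<open>e > 0\<close>] .
      then have "(\<alpha> ^^ m) x \<in> \<alpha> ` ?P" using iter by (cases m) auto
      with m(2) show ?thesis by blast
    qed
    then have "x \<in> closure (\<alpha> ` ?P)" by (simp add: closure_approachable)
    then show "x \<in> \<alpha> ` ?P"
      using complete_imp_closed[OF complete_isometric_image_on[OF peripheral_complete peripheral_dist]]
      by (simp add: closure_closed)
  qed
  ultimately show ?thesis using peripheral_maps by (auto simp: bij_betw_def)
qed

lemma peripheral_iterate_bij: "bij_betw (\<alpha> ^^ n) (peripheral_space S \<alpha>) (peripheral_space S \<alpha>)"
  by (rule bij_betw_funpow[OF peripheral_bij])

lemma peripheral_iterate_isometric: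
  "x \<in> peripheral_space S \<alpha> \<Longrightarrow> norm ((\<alpha> ^^ n) x) = norm x"
proof (induction n)
  case (Suc n)
  have "(\<alpha> ^^ n) x \<in> peripheral_space S \<alpha>"
    using Suc.prems bij_betwE[OF peripheral_iterate_bij] by blast
  then show ?case using Suc by (simp add: peripheral_isometric)
qed simp

lemma peripheral_space_of_peripheral_space:
  "peripheral_space (peripheral_space S \<alpha>) \<alpha> = peripheral_space S \<alpha>"
proof -
  have "{x \<in> peripheral_space S \<alpha>. \<exists>c. cmod c = 1 \<and> \<alpha> x = c *\<^sub>C x} =
      {x \<in> S. \<exists>c. cmod c = 1 \<and> \<alpha> x = c *\<^sub>C x}"
    using peripheral_subset eigenvector_in_peripheral_space by blast
  then show ?thesis by (simp only: peripheral_space_def[of "peripheral_space S \<alpha>"])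
      (simp add: peripheral_space_def)
qed

end

section \<open>Concrete C*-algebras\<close>

text \<open>Strong convergence implies convergence of all matrix coefficients, that is, convergence for
  the topology in which von Neumann algebras are closed.\<close>

lemma von_neumann_algebra_strong_limit:
  assumes M: "von_neumann_algebra M" and y: "\<And>n. y n \<in> M"
    and lim: "\<And>h. (\<lambda>n. blinfun_apply (y n) h) \<longlonglongrightarrow> blinfun_apply z h"
  shows "z \<in> M"
proof (rule ccontr)
  assume "z \<notin> M"
  have Mb: "M \<subseteq> bops" and cl: "closedin wot M" using M by (auto simp: von_neumann_algebra_def)
  have "z \<in> bops"
  proof -
    have "z (c *\<^sub>C v) = c *\<^sub>C z v" for c v
    proof (rule LIMSEQ_unique)
      show "(\<lambda>n. y n (c *\<^sub>C v)) \<longlonglongrightarrow> z (c *\<^sub>C v)" by (rule lim)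
      have "y n (c *\<^sub>C v) = c *\<^sub>C y n v" for n using y Mb bops_scaleC by blast
      then show "(\<lambda>n. y n (c *\<^sub>C v)) \<longlonglongrightarrow> c *\<^sub>C z v"
        using bounded_linear.tendsto[OF bounded_linear_scaleC lim] by simp
    qed
    then show ?thesis by (simp add: bops_def)
  qed
  define f :: "('a \<Rightarrow>\<^sub>L 'a) \<Rightarrow> 'a \<times> 'a \<Rightarrow> complex"
    where "f x = (\<lambda>(\<xi>, \<eta>). cinner \<xi> (blinfun_apply x \<eta>))" for x
  have wot: "wot = pullback_topology bops f euclidean" unfolding wot_def f_def by simp
  have "topspace (wot :: ('a \<Rightarrow>\<^sub>L 'a) topology) = bops" by (simp add: wot topspace_pullback_topology)
  with cl have "openin wot (bops - M)" by (simp add: closedin_def)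
  then obtain U where U: "open U" "bops - M = f -` U \<inter> bops"
    by (auto simp: wot openin_pullback_topology)
  have "(\<lambda>n. f (y n)) \<longlonglongrightarrow> f z"
    unfolding limitin_canonical_iff[symmetric] euclidean_product_topology[symmetric] f_def
    using lim by (auto simp: limitin_componentwise intro: tendsto_cinner_right)
  moreover have "f z \<in> U" using U(2) \<open>z \<in> bops\<close> \<open>z \<notin> M\<close> by blast
  ultimately have "\<forall>\<^sub>F n in sequentially. f (y n) \<in> U" by (rule topological_tendstoD[OF _ U(1)])
  then obtain n where "f (y n) \<in> U" by (auto simp: eventually_sequentially)
  then show False using U(2) y Mb by blast
qed

text \<open>concrete\<close>

text \<open>The common frame for von Neumann algebras and for the peripheral space of an endomorphism,
  which is norm closed but in general not weakly closed.\<close>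

definition concrete_cstar_algebra :: "('a::chilbert_space \<Rightarrow>\<^sub>L 'a) set \<Rightarrow> bool" where
  "concrete_cstar_algebra M \<longleftrightarrow>
     M \<subseteq> bops \<and> csubspace M \<and> closed M \<and> id_blinfun \<in> M \<and>
     (\<forall>x\<in>M. \<forall>y\<in>M. x o\<^sub>L y \<in> M) \<and> (\<forall>x\<in>M. adj x \<in> M)"

lemma concrete_cstar_von_neumann:
  assumes M: "von_neumann_algebra M" shows "concrete_cstar_algebra M"
proof -
  have "closed M"
  proof (rule closed_sequential_limits[THEN iffD2], intro allI impI, elim conjE)
    fix y z assume y: "\<forall>n. y n \<in> M" and lim: "y \<longlonglongrightarrow> z"
    show "z \<in> M"
      by (rule von_neumann_algebra_strong_limit[OF M, of y])
        (use y in blast, rule blinfun.tendsto[OF lim tendsto_const])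
  qed
  then show ?thesis using M by (simp add: von_neumann_algebra_def concrete_cstar_algebra_def)
qed

lemma unital_cstar_algebra_concrete:
  assumes M: "concrete_cstar_algebra M" shows "unital_cstar_algebra (operator_algebra M)"
proof -
  have b: "x \<in> bops" if "x \<in> M" for x using M that by (auto simp: concrete_cstar_algebra_def)
  have id: "x o\<^sub>L id_blinfun = x" "id_blinfun o\<^sub>L x = x" for x :: "'a \<Rightarrow>\<^sub>L 'a"
    by (rule blinfun_eqI, simp)+
  have assoc: "(x o\<^sub>L y) o\<^sub>L z = x o\<^sub>L (y o\<^sub>L z)" for x y z :: "'a \<Rightarrow>\<^sub>L 'a"
    by (rule blinfun_eqI) simp
  show ?thesis
    using M unfolding concrete_cstar_algebra_def operator_algebra_def
    by unfold_locales
      (auto simp: b compose_scaleC_left compose_scaleC_right id assoc adj_adj adj_add adj_scaleC adj_compose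
        norm_adj_compose_self norm_blinfun_compose complete_eq_closed
        bounded_bilinear.add_left[OF bounded_bilinear_blinfun_compose]
        bounded_bilinear.add_right[OF bounded_bilinear_blinfun_compose])
qed

lemma operator_algebra_simps [simp]:
  "cs_carrier (operator_algebra M) = M" "cs_mult (operator_algebra M) = (o\<^sub>L)"
  "cs_one (operator_algebra M) = id_blinfun" "cs_star (operator_algebra M) = adj"
  by (simp_all add: operator_algebra_def)

text \<open>The usual spectral argument without spectral theory. Put \<open>a = z\<^sup>*z\<close> and suppose
  that \<open>r = \<parallel>f(z)\<parallel>\<^sup>2\<close> exceeds \<open>\<parallel>a\<parallel> = \<parallel>z\<parallel>\<^sup>2\<close>. Then \<open>r - a\<close> has a left inverse \<open>w\<close> in the
  algebra, and \<open>f(w)\<close> is a left inverse of \<open>r - f(a)\<close>. But \<open>r\<close> is an approximate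
  eigenvalue of \<open>f(a)\<close>: at unit vectors that nearly attain the norm of \<open>f(z)\<close>, the operator \<open>r - f(a)\<close>
  is nearly zero.\<close>

lemma star_hom_contractive:
  assumes M: "concrete_cstar_algebra M" and N: "concrete_cstar_algebra N"
    and f: "unital_star_hom (operator_algebra M) (operator_algebra N) f" and z: "z \<in> M"
  shows "norm (f z) \<le> norm z"
proof (rule ccontr)
  assume "\<not> norm (f z) \<le> norm z"
  then have less: "norm z < norm (f z)" by simp
  have b: "x \<in> bops" if "x \<in> M" for x using M that by (auto simp: concrete_cstar_algebra_def)
  have fb: "f x \<in> bops" if "x \<in> M" for x
    using f N that by (auto simp: concrete_cstar_algebra_def unital_star_hom_def)
  define a where "a = adj z o\<^sub>L z"
  define r where "r = (norm (f z))\<^sup>2"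
  have a: "a \<in> M" using M z by (simp add: a_def concrete_cstar_algebra_def)
  have fa: "f a = adj (f z) o\<^sub>L f z"
    using M f z by (simp add: a_def concrete_cstar_algebra_def unital_star_hom_def)
  have a_less: "norm a < r"
    using less by (simp add: a_def r_def norm_adj_compose_self b z power_strict_mono)
  then have r: "r > 0" using norm_ge_zero[of a] by linarith
  have scaleR_M: "s *\<^sub>R x \<in> M" if "x \<in> M" for s x
    using M that complex_vector.subspace_scale[of M x "of_real s"]
    by (simp add: concrete_cstar_algebra_def scaleC_of_real)
  \<comment> \<open>A fixed point \<open>w\<close> of \<open>?g\<close> satisfies \<open>w(r - a) = 1\<close>; the iteration of \<open>?g\<close> is the Neumann series.\<close>
  let ?g = "\<lambda>w. (1 / r) *\<^sub>R (id_blinfun + (w o\<^sub>L a))"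
  have "\<exists>!w. w \<in> M \<and> ?g w = w"
  proof (rule Banach_fix[where c = "norm a / r"])
    show "complete M" "M \<noteq> {}"
      using M by (auto simp: concrete_cstar_algebra_def complete_eq_closed)
    show "0 \<le> norm a / r" "norm a / r < 1" using r a_less by auto
    have "id_blinfun + (w o\<^sub>L a) \<in> M" if "w \<in> M" for w
      using M that a by (intro complex_vector.subspace_add) (auto simp: concrete_cstar_algebra_def)
    then show "?g ` M \<subseteq> M" using scaleR_M by blast
    show "dist (?g v) (?g w) \<le> norm a / r * dist v w" if "v \<in> M" "w \<in> M" for v w
    proof -
      have "?g v - ?g w = (1 / r) *\<^sub>R ((v - w) o\<^sub>L a)"
        by (simp add: bounded_bilinear.diff_left[OF bounded_bilinear_blinfun_compose]
            scaleR_diff_right scaleR_add_right)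
      then have "dist (?g v) (?g w) = norm ((v - w) o\<^sub>L a) / r"
        using r by (simp add: dist_norm)
      also have "\<dots> \<le> norm (v - w) * norm a / r"
        using r by (intro divide_right_mono norm_blinfun_compose) auto
      finally show ?thesis by (simp add: dist_norm mult.commute)
    qed
  qed
  then obtain w where w: "w \<in> M" "?g w = w" by blast
  have w_inv: "id_blinfun + (w o\<^sub>L a) = r *\<^sub>R w"
    using arg_cong[OF w(2), of "\<lambda>v. r *\<^sub>R v"] r by simp
  have "f (id_blinfun + (w o\<^sub>L a)) = id_blinfun + (f w o\<^sub>L f a)"
    using f M w(1) a by (simp add: unital_star_hom_def clinear_on_def concrete_cstar_algebra_def)
  moreover have "f (r *\<^sub>R w) = r *\<^sub>R f w"
    using f w(1) by (simp add: unital_star_hom_def clinear_on_def flip: scaleC_of_real)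
  ultimately have fw: "id_blinfun + (f w o\<^sub>L f a) = r *\<^sub>R f w" by (simp add: w_inv)
  have left_inv: "f w (r *\<^sub>R h - f a h) = h" for h
    using arg_cong[OF fw, of "\<lambda>x. blinfun_apply x h"]
    by (simp add: blinfun.bilinear_simps algebra_simps)
  \<comment> \<open>The first summand is what the estimate of \<open>low\<close> yields; the second ensures \<open>0 < D\<close> and \<open>1 / D \<le> r\<close>.\<close>
  define D where "D = 2 * (norm (f w))\<^sup>2 * r + 1 / r"
  have D: "D > 0" unfolding D_def using r by (intro add_nonneg_pos) auto
  have low: "(norm h)\<^sup>2 \<le> D * (r * (norm h)\<^sup>2 - (norm (f z h))\<^sup>2)" for h
  proof -
    have le1: "(norm (f z h))\<^sup>2 \<le> r * (norm h)\<^sup>2"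
      using power_mono[OF norm_blinfun[of "f z" h], of 2] by (simp add: r_def power_mult_distrib)
    have "norm (f a h) \<le> norm (f z) * norm (f z h)"
      using norm_blinfun[of "adj (f z)" "f z h"] by (simp add: fa norm_adj fb z)
    then have "(norm (f a h))\<^sup>2 \<le> r * (norm (f z h))\<^sup>2"
      using power_mono[of _ _ 2] by (fastforce simp: r_def power_mult_distrib)
    also have "\<dots> \<le> r * (r * (norm h)\<^sup>2)" using le1 r by (intro mult_left_mono) auto
    finally have le2: "(norm (f a h))\<^sup>2 \<le> r * (r * (norm h)\<^sup>2)" .
    have "h \<bullet> f a h = (norm (f z h))\<^sup>2"
      by (simp add: fa power2_norm_eq_inner inner_adj fb z)
    then have "(norm (r *\<^sub>R h - f a h))\<^sup>2 = r * (r * (norm h)\<^sup>2) - 2 * r * (norm (f z h))\<^sup>2 + (norm (f a h))\<^sup>2"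
      unfolding power2_norm_eq_inner
      by (simp add: inner_simps inner_commute algebra_simps)
    also have "\<dots> \<le> 2 * r * (r * (norm h)\<^sup>2 - (norm (f z h))\<^sup>2)"
      using le2 by (simp add: algebra_simps)
    finally have le3: "(norm (r *\<^sub>R h - f a h))\<^sup>2 \<le> 2 * r * (r * (norm h)\<^sup>2 - (norm (f z h))\<^sup>2)" .
    have "(norm h)\<^sup>2 \<le> (norm (f w) * norm (r *\<^sub>R h - f a h))\<^sup>2"
      using norm_blinfun[of "f w" "r *\<^sub>R h - f a h"] by (intro power_mono) (simp_all add: left_inv)
    also have "\<dots> \<le> (norm (f w))\<^sup>2 * (2 * r * (r * (norm h)\<^sup>2 - (norm (f z h))\<^sup>2))"
      unfolding power_mult_distrib by (intro mult_left_mono le3) simp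
    also have "\<dots> \<le> D * (r * (norm h)\<^sup>2 - (norm (f z h))\<^sup>2)"
    proof -
      have "W * (2 * r * t) \<le> (2 * W * r + 1 / r) * t" if "0 \<le> t" for W t :: real
        using that r by (simp add: algebra_simps)
      then show ?thesis unfolding D_def using le1 by simp
    qed
    finally show ?thesis .
  qed
  have D_ge: "1 / D \<le> r"
  proof -
    have "1 / r \<le> D" using r by (simp add: D_def)
    then show ?thesis using r D by (simp add: field_simps)
  qed
  have "norm (f z) \<le> sqrt (r - 1 / D)"
  proof (rule norm_blinfun_bound)
    show "0 \<le> sqrt (r - 1 / D)" using D_ge by simp
    fix h
    have "(norm h)\<^sup>2 / D \<le> r * (norm h)\<^sup>2 - (norm (f z h))\<^sup>2"
      using low[of h] D by (simp add: pos_divide_le_eq mult.commute)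
    then have "(norm (f z h))\<^sup>2 \<le> (r - 1 / D) * (norm h)\<^sup>2"
      by (simp add: left_diff_distrib)
    also have "\<dots> = (sqrt (r - 1 / D) * norm h)\<^sup>2"
      using D_ge by (simp add: power_mult_distrib)
    finally show "norm (f z h) \<le> sqrt (r - 1 / D) * norm h"
      by (rule power2_le_imp_le) (use D_ge in simp)
  qed
  then have "r \<le> (sqrt (r - 1 / D))\<^sup>2" unfolding r_def by (rule power_mono) simp
  then have "r \<le> r - 1 / D" using D_ge by simp
  then show False using D by simp
qed

lemma unital_star_hom_funpow:
  assumes f: "unital_star_hom C C f"
  shows "unital_star_hom C C (f ^^ n)"
proof (induction n)
  case 0
  show ?case by (simp add: unital_star_hom_def clinear_on_def)
next
  case (Suc n)
  have "(f ^^ n) x \<in> cs_carrier C" if "x \<in> cs_carrier C" for x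
    using Suc that by (auto simp: unital_star_hom_def)
  with Suc f show ?case
    unfolding unital_star_hom_def clinear_on_def by auto
qed

lemma unital_cstar_algebra_isometric_image:
  assumes C: "unital_cstar_algebra C" and f: "unital_star_hom C D f"
    and onto: "f ` cs_carrier C = cs_carrier D"
    and iso: "\<And>x. x \<in> cs_carrier C \<Longrightarrow> norm (f x) = norm x"
  shows "unital_cstar_algebra D"
proof -
  interpret C: unital_cstar_algebra C by (rule C)
  note cl = C.mult_closed C.star_closed C.one_closed complex_vector.subspace_add[OF C.subspace]
    complex_vector.subspace_scale[OF C.subspace]
  have hom:
    "\<And>x y. x \<in> cs_carrier C \<Longrightarrow> y \<in> cs_carrier C \<Longrightarrow> f x + f y = f (x + y)"
    "\<And>c x. x \<in> cs_carrier C \<Longrightarrow> c *\<^sub>C f x = f (c *\<^sub>C x)"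
    "\<And>x y. x \<in> cs_carrier C \<Longrightarrow> y \<in> cs_carrier C \<Longrightarrow> f x \<otimes>\<^bsub>D\<^esub> f y = f (x \<otimes>\<^bsub>C\<^esub> y)"
    "\<And>x. x \<in> cs_carrier C \<Longrightarrow> cs_star D (f x) = f (cs_star C x)"
    "\<one>\<^bsub>D\<^esub> = f \<one>\<^bsub>C\<^esub>"
    using f by (simp_all add: unital_star_hom_def clinear_on_def)
  have D: "cs_carrier D = f ` cs_carrier C" by (rule onto[symmetric])
  have "dist (f x) (f y) = dist x y" if "x \<in> cs_carrier C" "y \<in> cs_carrier C" for x y
  proof -
    have "f x - f y = f x + (-1) *\<^sub>C f y" by (simp add: scaleC_one)
    also have "\<dots> = f (x + (-1) *\<^sub>C y)" using that by (simp only: hom cl)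
    also have "x + (-1) *\<^sub>C y = x - y" by (simp add: scaleC_one)
    finally have "f x - f y = f (x - y)" .
    moreover have "x - y \<in> cs_carrier C" using that by (rule complex_vector.subspace_diff[OF C.subspace])
    ultimately show ?thesis by (simp add: dist_norm iso)
  qed
  then have compl: "complete (cs_carrier D)"
    unfolding D by (rule complete_isometric_image_on[OF C.complete])
  have "0 = f 0"
    using hom(2)[of 0 0] complex_vector.subspace_0[OF C.subspace] by simp
  then have subsp: "csubspace (cs_carrier D)"
    unfolding complex_vector.subspace_def D
    using complex_vector.subspace_0[OF C.subspace] by (auto simp: hom cl intro!: imageI)
  show ?thesis
    by (unfold_locales, rule subsp, rule compl, unfold D)
      (auto simp: hom cl iso C.mult_assoc C.mult_one C.one_mult C.mult_add_right C.mult_add_left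
        C.mult_scaleC_right C.mult_scaleC_left C.star_star C.star_add C.star_scaleC C.star_mult
        C.norm_mult_le C.cstar_identity)
qed

lemma linear_contraction_star_hom:
  assumes M: "concrete_cstar_algebra M"
    and f: "unital_star_hom (operator_algebra M) (operator_algebra M) f"
  shows "linear_contraction M f"
proof
  show "csubspace M" "complete M"
    using M by (simp_all add: concrete_cstar_algebra_def complete_eq_closed)
  show "f ` M \<subseteq> M" "clinear_on M f" using f by (simp_all add: unital_star_hom_def)
  show "norm (f x) \<le> norm x" if "x \<in> M" for x by (rule star_hom_contractive[OF M M f that])
qed

text \<open>Products and adjoints of eigenvectors are eigenvectors, with eigenvalues \<open>cd\<close> and \<open>cnj c\<close>.
  The passage to the closed span is made in one variable at a time.\<close>

lemma concrete_cstar_peripheral: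
  assumes M: "concrete_cstar_algebra M"
    and f: "unital_star_hom (operator_algebra M) (operator_algebra M) f"
  shows "concrete_cstar_algebra (peripheral_space M f)"
proof -
  interpret linear_contraction M f by (rule linear_contraction_star_hom[OF M f])
  let ?P = "peripheral_space M f"
  have MD: "id_blinfun \<in> M" "\<And>x y. x \<in> M \<Longrightarrow> y \<in> M \<Longrightarrow> x o\<^sub>L y \<in> M"
    "\<And>x. x \<in> M \<Longrightarrow> adj x \<in> M" "\<And>x. x \<in> M \<Longrightarrow> x \<in> bops" "closed M"
    using M by (auto simp: concrete_cstar_algebra_def)
  have fD: "f id_blinfun = id_blinfun" "\<And>x y. x \<in> M \<Longrightarrow> y \<in> M \<Longrightarrow> f (x o\<^sub>L y) = f x o\<^sub>L f y"
    "\<And>x. x \<in> M \<Longrightarrow> f (adj x) = adj (f x)"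
    using f by (simp_all add: unital_star_hom_def)
  note bil = bounded_bilinear_blinfun_compose
  note bil_simps = bounded_bilinear.add_left[OF bil] bounded_bilinear.add_right[OF bil]
    bounded_bilinear.zero_left[OF bil] bounded_bilinear.zero_right[OF bil]
  have sub: "csubspace ?P" by (rule csubspace_peripheral_space)
  note subD = complex_vector.subspace_add[OF sub] complex_vector.subspace_scale[OF sub]
    complex_vector.subspace_0[OF sub] complex_vector.subspace_add[OF subspace]
    complex_vector.subspace_scale[OF subspace] complex_vector.subspace_0[OF subspace]
  have eigen_mult: "x o\<^sub>L y \<in> ?P" if x: "x \<in> M" "cmod c = 1" "f x = c *\<^sub>C x" and y: "y \<in> ?P" for x y c
  proof -
    have "closed (M \<inter> (\<lambda>y. x o\<^sub>L y) -` ?P)"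
      by (intro continuous_closed_preimage continuous_intros MD closed_peripheral_space
          linear_continuous_on bounded_bilinear.bounded_linear_right[OF bil])
    moreover have "csubspace (M \<inter> (\<lambda>y. x o\<^sub>L y) -` ?P)"
      unfolding complex_vector.subspace_def by (auto simp: bil_simps compose_scaleC_right MD x subD)
    ultimately have "?P \<subseteq> M \<inter> (\<lambda>y. x o\<^sub>L y) -` ?P"
    proof (intro peripheral_space_minimal)
      fix y d assume y: "y \<in> M" "cmod d = 1" "f y = d *\<^sub>C y"
      have "x o\<^sub>L y \<in> ?P"
        by (rule eigenvector_in_peripheral_space[where c = "c * d"])
          (simp_all add: MD x y norm_mult fD compose_scaleC_left compose_scaleC_right in_S scaleC_scaleC)
      with y show "y \<in> M \<inter> (\<lambda>y. x o\<^sub>L y) -` ?P" by simp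
    qed
    with y show ?thesis by blast
  qed
  have mult: "x o\<^sub>L y \<in> ?P" if x: "x \<in> ?P" and y: "y \<in> ?P" for x y
  proof -
    have "closed ((\<lambda>x. x o\<^sub>L y) -` ?P)"
      by (intro continuous_closed_vimage closed_peripheral_space
          linear_continuous_at bounded_bilinear.bounded_linear_left[OF bil])
    moreover have "csubspace ((\<lambda>x. x o\<^sub>L y) -` ?P)"
      unfolding complex_vector.subspace_def by (auto simp: bil_simps compose_scaleC_left subD)
    ultimately have "?P \<subseteq> (\<lambda>x. x o\<^sub>L y) -` ?P"
      by (intro peripheral_space_minimal) (auto intro: eigen_mult y)
    with x show ?thesis by blast
  qed
  have star: "adj x \<in> ?P" if x: "x \<in> ?P" for x
  proof -
    have "continuous_on M adj"
    proof (rule continuous_onI)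
      fix x e assume x: "x \<in> M" and e: "0 < (e::real)"
      have "dist (adj y) (adj x) = dist y x" if "y \<in> M" for y
      proof -
        have "adj y = adj (y - x) + adj x"
          using adj_add[of "y - x" x] complex_vector.subspace_diff[OF csubspace_bops MD(4)[OF that] MD(4)[OF x]]
            MD(4)[OF x] by simp
        then have "dist (adj y) (adj x) = norm (adj (y - x))" by (simp add: dist_norm)
        then show ?thesis
          using norm_adj[OF complex_vector.subspace_diff[OF csubspace_bops MD(4)[OF that] MD(4)[OF x]]]
          by (simp add: dist_norm)
      qed
      with e show "\<exists>d>0. \<forall>y\<in>M. dist y x < d \<longrightarrow> dist (adj y) (adj x) \<le> e" by force
    qed
    then have "closed (M \<inter> adj -` ?P)"
      by (rule continuous_closed_preimage[OF _ MD(5) closed_peripheral_space])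
    moreover have "adj (0 :: 'a \<Rightarrow>\<^sub>L 'a) = 0"
      using adj_scaleC[OF id_in_bops, of 0] by simp
    then have "csubspace (M \<inter> adj -` ?P)"
      unfolding complex_vector.subspace_def
      by (auto simp: adj_add adj_scaleC MD subD)
    ultimately have "?P \<subseteq> M \<inter> adj -` ?P"
    proof (intro peripheral_space_minimal)
      fix y d assume y: "y \<in> M" "cmod d = 1" "f y = d *\<^sub>C y"
      have "adj y \<in> ?P"
        by (rule eigenvector_in_peripheral_space[where c = "cnj d"])
          (simp_all add: MD y fD adj_scaleC)
      with y show "y \<in> M \<inter> adj -` ?P" by simp
    qed
    with x show ?thesis by blast
  qed
  have "id_blinfun \<in> ?P"
    by (rule eigenvector_in_peripheral_space[where c = 1]) (simp_all add: MD fD scaleC_one)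
  then show ?thesis
    unfolding concrete_cstar_algebra_def
    using sub closed_peripheral_space peripheral_subset MD(4) mult star by blast
qed

section \<open>The minimal dilation\<close>

locale poisson_dilation =
  fixes A :: "('h::chilbert_space \<Rightarrow>\<^sub>L 'h) set"
    and \<tau> :: "('h \<Rightarrow>\<^sub>L 'h) \<Rightarrow> ('h \<Rightarrow>\<^sub>L 'h)"
    and V :: "'h \<Rightarrow>\<^sub>L 'k::chilbert_space"
    and B :: "('k \<Rightarrow>\<^sub>L 'k) set"
    and \<theta> :: "('k \<Rightarrow>\<^sub>L 'k) \<Rightarrow> ('k \<Rightarrow>\<^sub>L 'k)"
  assumes A: "von_neumann_algebra A"
    and tau: "normal_ucp_map A \<tau>"
    and dilation: "minimal_dilation A \<tau> V B \<theta>"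
begin

abbreviation p where "p \<equiv> range_proj V"
abbreviation T where "T \<equiv> compress_op V"
abbreviation E where "E \<equiv> embed_op V"
text \<open>The projections \<open>\<theta>\<^sup>n(p)\<close> form an increasing exhaustion of \<open>\<K>\<close>.\<close>

definition q :: "nat \<Rightarrow> 'k \<Rightarrow>\<^sub>L 'k" where "q n = (\<theta> ^^ n) p"

lemma dilation_facts:
  shows "isometric_embedding V" "von_neumann_algebra B"
    "E ` A = (\<lambda>z. p o\<^sub>L z o\<^sub>L p) ` B"
    "unital_star_hom (operator_algebra B) (operator_algebra B) \<theta>"
    "\<forall>x\<in>A. \<forall>n. E ((\<tau> ^^ n) x) = p o\<^sub>L (\<theta> ^^ n) (E x) o\<^sub>L p"
    "closure (cspan {dilation_vector \<theta> x (V h) n | x h n. \<forall>i. x i \<in> E ` A}) = UNIV"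
    "B = generated_von_neumann_algebra {(\<theta> ^^ n) (E x) | n x. x \<in> A}"
  using dilation unfolding minimal_dilation_def by blast+

lemma V_bops: "V \<in> bops" and norm_V: "norm (V h) = norm h"
  using dilation_facts(1) by (auto simp: isometric_embedding_def)

lemma adjV_V: "adj V (V h) = h"
proof -
  have "V u \<bullet> V h = u \<bullet> h" for u
    by (simp add: dot_norm norm_V flip: blinfun.add_right)
  then show ?thesis by (metis V_bops inner_adj vector_eq_ldot)
qed

lemma E_apply: "E x k = V (x (adj V k))" and T_apply: "T z h = adj V (z (V h))"
  and p_apply: "p k = V (adj V k)"
  by (simp_all add: embed_op_def compress_op_def range_proj_def)

lemma T_E: "T (E x) = x"
  by (rule blinfun_eqI) (simp add: E_apply T_apply adjV_V)

lemma E_T: "E (T z) = p o\<^sub>L z o\<^sub>L p"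
  by (rule blinfun_eqI) (simp add: E_apply T_apply p_apply)

lemma T_p_p: "T (p o\<^sub>L z o\<^sub>L p) = T z"
  by (metis E_T T_E)

lemma p_E: "p o\<^sub>L E x = E x"
  by (rule blinfun_eqI) (simp add: E_apply p_apply adjV_V)

lemma E_id: "E id_blinfun = p"
  by (rule blinfun_eqI) (simp add: E_apply p_apply)

lemma adj_p: "adj p = p"
  by (simp add: range_proj_def adj_compose adj_adj V_bops adj_in_bops)

lemma norm_E_le: "norm (E x) \<le> norm x" and norm_T_le: "norm (T z) \<le> norm z"
proof -
  have V1: "norm V \<le> 1" by (rule norm_blinfun_bound) (simp_all add: norm_V)
  then have V2: "norm (adj V) \<le> 1" by (simp add: norm_adj V_bops)
  have "norm (y k) \<le> norm k" if "norm y \<le> 1" for y :: "'c::real_normed_vector \<Rightarrow>\<^sub>L 'd::real_normed_vector" and k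
    using norm_blinfun[of y k] mult_right_mono[OF that norm_ge_zero[of k]] by simp
  note le = this[OF V1] this[OF V2]
  have "norm (E x k) \<le> norm x * norm k" for k
    unfolding E_apply norm_V
    by (rule order_trans[OF norm_blinfun]) (intro mult_left_mono le norm_ge_zero)
  then show "norm (E x) \<le> norm x" by (intro norm_blinfun_bound) auto
  have "norm (T z h) \<le> norm z * norm h" for h
    unfolding T_apply using le(2)[of "z (V h)"] norm_blinfun[of z "V h"] by (simp add: norm_V)
  then show "norm (T z) \<le> norm z" by (intro norm_blinfun_bound) auto
qed

lemma T_adj: "z \<in> bops \<Longrightarrow> T (adj z) = adj (T z)"
  by (rule adj_eqI[symmetric]) (simp add: T_apply cinner_adj_left cinner_adj V_bops)

lemma T_add: "T (y + z) = T y + T z"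
  by (rule blinfun_eqI) (simp add: T_apply blinfun.bilinear_simps)

lemma T_scaleC: "T (c *\<^sub>C z) = c *\<^sub>C T z"
  by (rule blinfun_eqI) (simp add: T_apply scaleC_blinfun.rep_eq bops_scaleC adj_in_bops V_bops)

lemma bounded_linear_T: "bounded_linear T"
proof (rule bounded_linear_intro[where K = 1])
  show "T (r *\<^sub>R z) = r *\<^sub>R T z" for r z using T_scaleC[of "of_real r" z] by (simp add: scaleC_of_real)
qed (simp_all add: T_add norm_T_le)

lemma B_vN: "von_neumann_algebra B"
  by (rule dilation_facts)

lemma B: "concrete_cstar_algebra B"
  by (rule concrete_cstar_von_neumann[OF B_vN])

lemma B_bops: "z \<in> B \<Longrightarrow> z \<in> bops"
  using B by (auto simp: concrete_cstar_algebra_def)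

lemma B_mult: "\<lbrakk>y \<in> B; z \<in> B\<rbrakk> \<Longrightarrow> y o\<^sub>L z \<in> B"
  using B by (auto simp: concrete_cstar_algebra_def)

lemma theta_hom: "unital_star_hom (operator_algebra B) (operator_algebra B) (\<theta> ^^ n)"
  by (rule unital_star_hom_funpow[OF dilation_facts(4)])

lemma theta_in_B: "z \<in> B \<Longrightarrow> (\<theta> ^^ n) z \<in> B"
  and theta_mult: "\<lbrakk>y \<in> B; z \<in> B\<rbrakk> \<Longrightarrow> (\<theta> ^^ n) (y o\<^sub>L z) = (\<theta> ^^ n) y o\<^sub>L (\<theta> ^^ n) z"
  and theta_adj: "z \<in> B \<Longrightarrow> (\<theta> ^^ n) (adj z) = adj ((\<theta> ^^ n) z)"
  and theta_scaleC: "z \<in> B \<Longrightarrow> (\<theta> ^^ n) (c *\<^sub>C z) = c *\<^sub>C (\<theta> ^^ n) z"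
  using theta_hom[of n] by (auto simp: unital_star_hom_def clinear_on_def)

lemma theta_norm_le: "z \<in> B \<Longrightarrow> norm ((\<theta> ^^ n) z) \<le> norm z"
  by (rule star_hom_contractive[OF B B theta_hom])

sublocale theta: linear_contraction B \<theta>
  using theta_hom[of 1] by (intro linear_contraction_star_hom[OF B]) simp

lemma E_in_B: "x \<in> A \<Longrightarrow> E x \<in> B"
proof -
  assume "x \<in> A"
  then have "E x \<in> {(\<theta> ^^ n) (E x) | n x. x \<in> A}"
    by (intro CollectI exI[of _ 0] exI[of _ x]) simp
  moreover have "B = generated_von_neumann_algebra {(\<theta> ^^ n) (E x) | n x. x \<in> A}"
    by (rule dilation_facts)
  ultimately show "E x \<in> B" unfolding generated_von_neumann_algebra_def by blast
qed

lemma p_in_B: "p \<in> B"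
  using E_in_B[of id_blinfun] A by (simp add: E_id von_neumann_algebra_def)

lemma T_in_A: "z \<in> B \<Longrightarrow> T z \<in> A"
proof -
  assume "z \<in> B"
  moreover note dilation_facts(3)
  ultimately have "p o\<^sub>L z o\<^sub>L p \<in> E ` A" by blast
  then obtain a where "a \<in> A" "p o\<^sub>L z o\<^sub>L p = E a" by blast
  then show ?thesis using T_p_p[of z] by (simp add: T_E)
qed

lemma dilates: "x \<in> A \<Longrightarrow> E ((\<tau> ^^ n) x) = p o\<^sub>L (\<theta> ^^ n) (E x) o\<^sub>L p"
  using dilation_facts(5) by blast

lemma q_in_B: "q n \<in> B"
  unfolding q_def by (rule theta_in_B[OF p_in_B])

lemma p_p: "p o\<^sub>L p = p"
  using p_E[of id_blinfun] by (simp add: E_id)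

lemma q_q: "q n o\<^sub>L q n = q n"
  unfolding q_def by (simp add: p_p p_in_B flip: theta_mult)

lemma adj_q: "adj (q n) = q n"
  unfolding q_def by (simp add: adj_p p_in_B flip: theta_adj)

lemma inner_q: "q n u \<bullet> v = u \<bullet> q n v"
  using inner_adj[OF B_bops[OF q_in_B]] by (simp add: adj_q)

text \<open>This is where unitality of \<open>\<tau>\<close> enters: \<open>p q\<^sub>n p = \<tau>\<^sup>n(1) = p\<close>, so that \<open>q\<^sub>n\<close> preserves the norm of every
  vector of \<open>\<H>\<close>, and a projection fixes the vectors whose norm it preserves.\<close>

lemma q_V: "q n (V h) = V h"
proof -
  have "(\<tau> ^^ n) id_blinfun = id_blinfun"
    using tau by (induction n) (simp_all add: normal_ucp_map_def)
  then have "p = p o\<^sub>L q n o\<^sub>L p"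
    using dilates[of id_blinfun n] A by (simp add: E_id q_def von_neumann_algebra_def)
  then have "adj V (p (V h)) = adj V ((p o\<^sub>L q n o\<^sub>L p) (V h))" by simp
  then have "h = adj V (q n (V h))" by (simp add: p_apply adjV_V)
  then have 1: "V h \<bullet> q n (V h) = V h \<bullet> V h"
    by (metis V_bops inner_adj adjV_V)
  have "q n (V h) \<bullet> q n (V h) = V h \<bullet> q n (V h)"
    by (metis inner_q q_q blinfun_apply_blinfun_compose)
  with 1 have "(q n (V h) - V h) \<bullet> (q n (V h) - V h) = 0"
    by (simp add: inner_simps inner_commute)
  then show ?thesis by simp
qed

lemma adjV_q: "adj V (q n k) = adj V k"
proof -
  have "u \<bullet> adj V (q n k) = u \<bullet> adj V k" for u
    by (simp add: q_V flip: inner_adj[OF V_bops] inner_q)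
  then show ?thesis using vector_eq_ldot by blast
qed

lemma q_p: "q n o\<^sub>L p = p"
  by (rule blinfun_eqI) (simp add: p_apply q_V)

text \<open>Applying the homomorphism \<open>\<theta>\<^sup>m\<close> to \<open>q\<^sub>k p = p\<close> gives \<open>q\<^sub>m\<^sub>+\<^sub>k q\<^sub>m = q\<^sub>m\<close>.\<close>

lemma q_mono: "m \<le> n \<Longrightarrow> q n o\<^sub>L q m = q m"
proof -
  assume "m \<le> n"
  then obtain k where n: "n = m + k" using le_Suc_ex by blast
  have "q n o\<^sub>L q m = (\<theta> ^^ m) (q k o\<^sub>L p)"
    by (simp add: n q_def[of "m + k"] q_def[of m] theta_mult q_in_B p_in_B funpow_add q_def[of k, symmetric])
  then show ?thesis by (simp add: q_p) (simp add: q_def)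
qed

lemma norm_q_le: "norm (q n h) \<le> norm h"
proof -
  have "norm (q n h) * norm (q n h) = h \<bullet> q n h"
    by (metis inner_q q_q blinfun_apply_blinfun_compose power2_norm_eq_inner power2_eq_square)
  also have "\<dots> \<le> norm h * norm (q n h)" by (rule norm_cauchy_schwarz)
  finally show ?thesis by (cases "q n h = 0") auto
qed

definition absorbed :: "'k set" where "absorbed = {h. \<exists>n. q n h = h}"

lemma q_fixed_later: "\<lbrakk>q m h = h; m \<le> n\<rbrakk> \<Longrightarrow> q n h = h"
  by (metis q_mono blinfun_apply_blinfun_compose)

text \<open>A vector \<open>\<theta>\<^sup>n(x\<^sub>n)\<cdots>\<theta>(x\<^sub>1)h\<close> lies in the range of \<open>q\<^sub>n\<close>, because \<open>p x\<^sub>n = x\<^sub>n\<close>. These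
  vectors span a dense subspace by minimality.\<close>

lemma absorbed_dense: "closure absorbed = UNIV"
proof -
  let ?S = "{dilation_vector \<theta> x (V h) n | x h n. \<forall>i. x i \<in> E ` A}"
  have "csubspace absorbed"
    unfolding complex_vector.subspace_def
  proof (intro conjI ballI allI)
    show "0 \<in> absorbed" by (simp add: absorbed_def)
    fix x y assume "x \<in> absorbed" "y \<in> absorbed"
    then obtain m n where "q m x = x" "q n y = y" by (auto simp: absorbed_def)
    then have "q (max m n) (x + y) = x + y" by (simp add: blinfun.add_right q_fixed_later)
    then show "x + y \<in> absorbed" by (auto simp: absorbed_def)
  next
    fix c x assume "x \<in> absorbed"
    then show "c *\<^sub>C x \<in> absorbed" by (auto simp: absorbed_def bops_scaleC B_bops q_in_B)
  qed
  moreover have "?S \<subseteq> absorbed"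
  proof clarify
    fix x :: "nat \<Rightarrow> 'k \<Rightarrow>\<^sub>L 'k" and h n assume x: "\<forall>i. x i \<in> E ` A"
    have "q n (dilation_vector \<theta> x (V h) n) = dilation_vector \<theta> x (V h) n"
    proof (cases n)
      case 0
      then show ?thesis by (simp add: q_V)
    next
      case (Suc m)
      have "q n o\<^sub>L (\<theta> ^^ n) (x n) = (\<theta> ^^ n) (x n)"
        unfolding q_def using x p_E E_in_B p_in_B by (metis theta_mult imageE)
      then show ?thesis by (metis Suc dilation_vector.simps(2) blinfun_apply_blinfun_compose)
    qed
    then show "dilation_vector \<theta> x (V h) n \<in> absorbed" by (auto simp: absorbed_def)
  qed
  ultimately have "cspan ?S \<subseteq> absorbed" by (intro complex_vector.span_minimal)
  moreover note dilation_facts(6)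
  ultimately show ?thesis using closure_mono by blast
qed

lemma absorbed_approx:
  assumes "e > 0" obtains d m where "\<And>n. n \<ge> m \<Longrightarrow> q n d = d" "norm (h - d) < e"
proof -
  have "h \<in> closure absorbed" by (simp add: absorbed_dense)
  then obtain d where "d \<in> absorbed" "dist d h < e" using assms closure_approachable by blast
  then obtain m where "q m d = d" "norm (h - d) < e"
    by (auto simp: absorbed_def dist_norm norm_minus_commute)
  then show thesis using that q_fixed_later by blast
qed

lemma q_strong: "(\<lambda>n. q n h) \<longlonglongrightarrow> h"
proof (rule LIMSEQ_I)
  fix e :: real assume "e > 0"
  then have "e / 2 > 0" by simp
  then obtain d m where d: "\<And>n. n \<ge> m \<Longrightarrow> q n d = d" "norm (h - d) < e / 2"
    using absorbed_approx[of "e / 2" h] by blast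
  have "norm (q n h - h) < e" if "n \<ge> m" for n
  proof -
    have "q n h - h = q n (h - d) - (h - d)" by (simp add: blinfun.diff_right d(1)[OF that])
    also have "norm \<dots> \<le> norm (q n (h - d)) + norm (h - d)" by (rule norm_triangle_ineq4)
    also have "\<dots> < e" using norm_q_le[of n "h - d"] d(2) by simp
    finally show ?thesis .
  qed
  then show "\<exists>m. \<forall>n\<ge>m. norm (q n h - h) < e" by blast
qed

text \<open>In particular an operator is determined by its corners \<open>q\<^sub>n z q\<^sub>n\<close>, and a uniform bound for
  the corners bounds the operator.\<close>

lemma q_compress_strong: "(\<lambda>n. (q n o\<^sub>L z o\<^sub>L q n) h) \<longlonglongrightarrow> z h"
proof (rule LIM_zero_cancel, rule tendsto_norm_zero_cancel, rule tendsto_sandwich)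
  show "\<forall>\<^sub>F n in sequentially. 0 \<le> norm ((q n o\<^sub>L z o\<^sub>L q n) h - z h)" by simp
  have "norm ((q n o\<^sub>L z o\<^sub>L q n) h - z h) \<le> norm z * norm (q n h - h) + norm (q n (z h) - z h)" for n
  proof -
    have "(q n o\<^sub>L z o\<^sub>L q n) h - z h = q n (z (q n h - h)) + (q n (z h) - z h)"
      by (simp add: blinfun.bilinear_simps)
    also have "norm \<dots> \<le> norm (q n (z (q n h - h))) + norm (q n (z h) - z h)" by (rule norm_triangle_ineq)
    also have "norm (q n (z (q n h - h))) \<le> norm z * norm (q n h - h)"
      by (rule order_trans[OF norm_q_le norm_blinfun])
    finally show ?thesis by simp
  qed
  then show "\<forall>\<^sub>F n in sequentially. norm ((q n o\<^sub>L z o\<^sub>L q n) h - z h)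
      \<le> norm z * norm (q n h - h) + norm (q n (z h) - z h)" by simp
  have "(\<lambda>n. norm z * norm (q n h - h) + norm (q n (z h) - z h)) \<longlonglongrightarrow> norm z * norm (h - h) + norm (z h - z h)"
    by (intro tendsto_intros q_strong)
  then show "(\<lambda>n. norm z * norm (q n h - h) + norm (q n (z h) - z h)) \<longlonglongrightarrow> 0" by simp
qed simp

text \<open>By definition of the dilation this holds for \<open>z\<close> in the corner \<open>p\<B>p\<close>. In general \<open>T(\<theta>(z))\<close> depends
  only on \<open>\<theta>(pzp) = q\<^sub>1 \<theta>(z) q\<^sub>1\<close>, since \<open>p \<le> q\<^sub>1\<close>.\<close>

lemma T_theta: "z \<in> B \<Longrightarrow> T (\<theta> z) = \<tau> (T z)"
proof -
  assume z: "z \<in> B"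
  have "E (\<tau> (T z)) = p o\<^sub>L \<theta> (p o\<^sub>L z o\<^sub>L p) o\<^sub>L p"
    using dilates[OF T_in_A[OF z], of 1] by (simp add: E_T)
  also have "\<theta> (p o\<^sub>L z o\<^sub>L p) = q 1 o\<^sub>L \<theta> z o\<^sub>L q 1"
    using theta_mult[of _ _ 1] by (simp add: q_def z p_in_B B_mult)
  finally have "T (E (\<tau> (T z))) = T (p o\<^sub>L (q 1 o\<^sub>L \<theta> z o\<^sub>L q 1) o\<^sub>L p)" by simp
  also have "\<dots> = T (\<theta> z)"
    by (rule blinfun_eqI) (simp add: T_p_p T_apply q_V adjV_q)
  finally show ?thesis by (simp add: T_E)
qed

section \<open>Lifting eigenvectors to the dilation\<close>

text \<open>For \<open>n = m + k\<close> the corner of \<open>\<theta>\<^sup>n(x)\<close> under \<open>q\<^sub>m\<close> is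
  \<open>\<theta>\<^sup>m(p \<theta>\<^sup>k(x) p) = \<theta>\<^sup>m(\<tau>\<^sup>k(x))\<close>, which is \<open>c\<^sup>k \<theta>\<^sup>m(x)\<close>. Since \<open>|c| = 1\<close>, the conjugate of \<open>c\<close> is
  its inverse.\<close>

lemma eigenvector_orbit_compress:
  assumes x: "x \<in> A" and c: "cmod c = 1" "\<tau> x = c *\<^sub>C x" and "m \<le> n"
  shows "q m o\<^sub>L (cnj c ^ n *\<^sub>C (\<theta> ^^ n) (E x)) o\<^sub>L q m = cnj c ^ m *\<^sub>C (\<theta> ^^ m) (E x)"
proof -
  obtain k where n: "n = m + k" using \<open>m \<le> n\<close> le_Suc_ex by blast
  have cc: "cnj c * c = 1" using c(1) by (metis complex_norm_square mult.commute of_real_1 one_power2)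
  have scale: "\<tau> (d *\<^sub>C x) = d *\<^sub>C \<tau> x" for d
    using tau x by (simp add: normal_ucp_map_def clinear_on_def)
  have pow: "(\<tau> ^^ k) x = c ^ k *\<^sub>C x"
    by (induction k) (simp_all add: scaleC_one scale c(2) scaleC_scaleC mult.commute)
  have E_sc: "E (c ^ k *\<^sub>C x) = c ^ k *\<^sub>C E x"
    by (rule blinfun_eqI) (simp add: E_apply scaleC_blinfun.rep_eq bops_scaleC V_bops)
  have "q m o\<^sub>L (\<theta> ^^ n) (E x) o\<^sub>L q m = (\<theta> ^^ m) (p o\<^sub>L (\<theta> ^^ k) (E x) o\<^sub>L p)"
    unfolding q_def n funpow_add comp_apply
    by (simp add: theta_mult B_mult p_in_B theta_in_B E_in_B x)
  also have "\<dots> = c ^ k *\<^sub>C (\<theta> ^^ m) (E x)"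
    by (simp add: dilates[OF x, symmetric] pow E_sc theta_scaleC E_in_B x)
  finally have "q m o\<^sub>L (\<theta> ^^ n) (E x) o\<^sub>L q m = c ^ k *\<^sub>C (\<theta> ^^ m) (E x)" .
  moreover have "q m o\<^sub>L (d *\<^sub>C z) o\<^sub>L q m = d *\<^sub>C (q m o\<^sub>L z o\<^sub>L q m)" for d z
    by (rule blinfun_eqI) (simp add: scaleC_blinfun.rep_eq bops_scaleC B_bops q_in_B)
  moreover have "cnj c ^ n * c ^ k = cnj c ^ m"
    by (simp add: n power_add mult.assoc cc flip: power_mult_distrib)
  ultimately show ?thesis by (simp add: scaleC_scaleC)
qed

text \<open>A bounded sequence in which each term is a corner of the later ones converges strongly. On a vector
  \<open>d\<close> that is eventually fixed by the \<open>q\<^sub>n\<close>, the vector \<open>y\<^sub>m d\<close> is the orthogonal projection of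
  \<open>y\<^sub>n d\<close> for \<open>m \<le> n\<close>. So the norms increase, and by Pythagoras they control the distances. Such vectors are dense and the
  operators are uniformly bounded, so convergence holds everywhere.\<close>

lemma compatible_strong_limit:
  assumes y: "\<And>n. y n \<in> B" and bound: "\<And>n. norm (y n) \<le> K"
    and compat: "\<And>m n. m \<le> n \<Longrightarrow> q m o\<^sub>L y n o\<^sub>L q m = y m"
  shows "\<exists>z\<in>B. \<forall>n. q n o\<^sub>L z o\<^sub>L q n = y n"
proof -
  have K: "K \<ge> 0" using bound[of 0] norm_ge_zero order_trans by blast
  have y_le: "norm (y n h) \<le> K * norm h" for n h
    by (rule order_trans[OF norm_blinfun]) (intro mult_right_mono bound norm_ge_zero)
  have Cauchy_absorbed: "Cauchy (\<lambda>n. y n d)" if d: "\<And>n. n \<ge> k \<Longrightarrow> q n d = d" for d k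
  proof (rule metric_CauchyI)
    fix e :: real assume "e > 0"
    have step: "q m (y n d) = y m d" if "k \<le> m" "m \<le> n" for m n
      using arg_cong[OF compat[OF that(2)], of "\<lambda>z. blinfun_apply z d"] d[OF that(1)] by simp
    have pyth: "(norm (y n d - y m d))\<^sup>2 = (norm (y n d))\<^sup>2 - (norm (y m d))\<^sup>2"
      if "k \<le> m" "m \<le> n" for m n
    proof -
      have "y n d \<bullet> y m d = y m d \<bullet> y m d"
        by (metis step[OF that] inner_q q_q blinfun_apply_blinfun_compose)
      then show ?thesis by (simp add: power2_norm_eq_inner inner_simps inner_commute)
    qed
    define s where "s n = (norm (y (n + k) d))\<^sup>2" for n
    have s_mono: "incseq s"
    proof (rule incseq_SucI)
      show "s n \<le> s (Suc n)" for n
        using pyth[of "n + k" "Suc n + k"] zero_le_power2[of "norm (y (Suc n + k) d - y (n + k) d)"]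
        by (simp add: s_def del: zero_le_power2)
    qed
    have "s n \<le> (K * norm d)\<^sup>2" for n
      unfolding s_def by (intro power_mono y_le norm_ge_zero)
    then obtain L where "s \<longlonglongrightarrow> L" using incseq_convergent[OF s_mono] by blast
    then have "Cauchy s" by (rule LIMSEQ_imp_Cauchy)
    then obtain M where M: "\<And>m n. m \<ge> M \<Longrightarrow> n \<ge> M \<Longrightarrow> dist (s m) (s n) < e\<^sup>2"
      using metric_CauchyD[of s "e\<^sup>2"] \<open>e > 0\<close> by auto
    have close: "dist (y m d) (y n d) < e" if mn: "M + k \<le> m" "m \<le> n" for m n
    proof -
      have "dist (s (m - k)) (s (n - k)) < e\<^sup>2" using mn by (intro M) auto
      then have "\<bar>(norm (y m d))\<^sup>2 - (norm (y n d))\<^sup>2\<bar> < e\<^sup>2"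
        using mn by (simp add: s_def dist_real_def)
      then have "(norm (y n d - y m d))\<^sup>2 < e\<^sup>2" using pyth[of m n] mn by simp
      then show ?thesis
        using \<open>e > 0\<close> by (simp add: dist_norm norm_minus_commute power2_less_imp_less)
    qed
    have "dist (y m d) (y n d) < e" if "M + k \<le> m" "M + k \<le> n" for m n
      using close[of m n] close[of n m] that by (cases "m \<le> n") (auto simp: dist_commute)
    then show "\<exists>M. \<forall>m\<ge>M. \<forall>n\<ge>M. dist (y m d) (y n d) < e" by blast
  qed
  have conv: "convergent (\<lambda>n. y n h)" for h
  proof (rule Cauchy_convergent, rule metric_CauchyI)
    fix e :: real assume e: "e > 0"
    define e' where "e' = e / (3 * (K + 1))"
    have e': "e' > 0" "K * e' \<le> e / 3" using e K by (auto simp: e'_def field_simps)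
    obtain d k where d: "\<And>n. n \<ge> k \<Longrightarrow> q n d = d" "norm (h - d) < e'"
      using absorbed_approx[OF e'(1), of h] by blast
    have "e / 3 > 0" using e by simp
    then obtain M where M: "\<And>m n. m \<ge> M \<Longrightarrow> n \<ge> M \<Longrightarrow> dist (y m d) (y n d) < e / 3"
      using metric_CauchyD[OF Cauchy_absorbed[OF d(1)]] by blast
    have near: "dist (y n h) (y n d) \<le> e / 3" for n
    proof -
      have "dist (y n h) (y n d) \<le> K * norm (h - d)"
        using y_le[of n "h - d"] by (simp add: dist_norm blinfun.diff_right)
      also have "\<dots> \<le> K * e'" using d(2) K by (intro mult_left_mono) auto
      finally show ?thesis using e'(2) by simp
    qed
    have "dist (y m h) (y n h) < e" if "m \<ge> M" "n \<ge> M" for m n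
      using near[of m] near[of n] M[OF that] dist_triangle[of "y m h" "y n h" "y m d"]
        dist_triangle[of "y m d" "y n h" "y n d"] by (simp add: dist_commute[of "y n d"])
    then show "\<exists>M. \<forall>m\<ge>M. \<forall>n\<ge>M. dist (y m h) (y n h) < e" by blast
  qed
  define g where "g h = lim (\<lambda>n. y n h)" for h
  have g: "(\<lambda>n. y n h) \<longlonglongrightarrow> g h" for h
    using conv by (simp add: g_def convergent_LIMSEQ_iff)
  have "bounded_linear g"
  proof (rule bounded_linear_intro[where K = K])
    show "g (u + v) = g u + g v" for u v
      by (rule LIMSEQ_unique[OF g]) (simp add: blinfun.add_right tendsto_add g)
    show "g (r *\<^sub>R v) = r *\<^sub>R g v" for r v
      by (rule LIMSEQ_unique[OF g]) (simp add: blinfun.scaleR_right tendsto_scaleR g)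
    show "norm (g v) \<le> norm v * K" for v
      by (rule LIMSEQ_le_const2[OF tendsto_norm[OF g]]) (use y_le in \<open>simp add: mult.commute\<close>)
  qed
  then have z: "(\<lambda>n. y n h) \<longlonglongrightarrow> Blinfun g h" for h
    by (simp add: bounded_linear_Blinfun_apply g)
  have "Blinfun g \<in> B" by (rule von_neumann_algebra_strong_limit[OF B_vN y z])
  moreover have "q m o\<^sub>L Blinfun g o\<^sub>L q m = y m" for m
  proof (rule blinfun_eqI)
    fix h
    have "(\<lambda>n. q m (y n (q m h))) \<longlonglongrightarrow> q m (Blinfun g (q m h))"
      by (intro blinfun.tendsto tendsto_const z)
    moreover have "\<forall>\<^sub>F n in sequentially. q m (y n (q m h)) = y m h"
      using arg_cong[OF compat, of _ _ "\<lambda>z. blinfun_apply z h"]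
      by (auto simp: eventually_sequentially)
    then have "(\<lambda>n. q m (y n (q m h))) \<longlonglongrightarrow> y m h" by (rule tendsto_eventually)
    ultimately show "(q m o\<^sub>L Blinfun g o\<^sub>L q m) h = y m h"
      by (auto dest: LIMSEQ_unique)
  qed
  ultimately show ?thesis by blast
qed

text \<open>The candidate is the strong limit of \<open>c\<^sup>-\<^sup>n\<theta>\<^sup>n(x)\<close>. The eigenvalue equation is checked on corners:
  \<open>\<theta>\<close> maps the corner under \<open>q\<^sub>n\<close> to the corner of the image under \<open>q\<^sub>n\<^sub>+\<^sub>1\<close>.\<close>

lemma eigenvector_lift:
  assumes x: "x \<in> A" and c: "cmod c = 1" "\<tau> x = c *\<^sub>C x"
  obtains z where "z \<in> B" "\<theta> z = c *\<^sub>C z" "T z = x"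
proof -
  define y where "y n = cnj c ^ n *\<^sub>C (\<theta> ^^ n) (E x)" for n
  have cc: "c * cnj c = 1" using c(1) by (metis complex_norm_square of_real_1 one_power2)
  have yB: "y n \<in> B" for n
    unfolding y_def using B x
    by (intro complex_vector.subspace_scale theta_in_B E_in_B) (auto simp: concrete_cstar_algebra_def)
  have "norm (y n) \<le> norm (E x)" for n
    using theta_norm_le[OF E_in_B[OF x]] by (simp add: y_def norm_scaleC norm_power c(1))
  moreover have "q m o\<^sub>L y n o\<^sub>L q m = y m" if "m \<le> n" for m n
    unfolding y_def by (rule eigenvector_orbit_compress[OF x c that])
  ultimately have "\<exists>z\<in>B. \<forall>n. q n o\<^sub>L z o\<^sub>L q n = y n"
    by (rule compatible_strong_limit[OF yB])
  then obtain z where z: "z \<in> B" "\<And>n. q n o\<^sub>L z o\<^sub>L q n = y n" by blast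
  have q_Suc: "q (Suc n) = \<theta> (q n)" for n by (simp add: q_def)
  have theta_y: "\<theta> (y n) = c *\<^sub>C y (Suc n)" for n
    using theta_scaleC[of "(\<theta> ^^ n) (E x)" 1] theta_in_B[OF E_in_B[OF x]] cc
    by (simp add: y_def scaleC_scaleC flip: mult.assoc)
  have eq: "q (Suc n) o\<^sub>L \<theta> z o\<^sub>L q (Suc n) = c *\<^sub>C (q (Suc n) o\<^sub>L z o\<^sub>L q (Suc n))" for n
  proof -
    have "q (Suc n) o\<^sub>L \<theta> z o\<^sub>L q (Suc n) = \<theta> (q n o\<^sub>L z o\<^sub>L q n)"
      using theta_mult[of _ _ 1] by (simp add: q_Suc z(1) q_in_B B_mult)
    also have "\<dots> = c *\<^sub>C y (Suc n)" by (simp only: z(2) theta_y)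
    finally show ?thesis by (simp only: z(2))
  qed
  have "\<theta> z = c *\<^sub>C z"
  proof (rule blinfun_eqI)
    fix h
    have "(\<lambda>n. (q (Suc n) o\<^sub>L \<theta> z o\<^sub>L q (Suc n)) h) \<longlonglongrightarrow> \<theta> z h"
      by (rule LIMSEQ_Suc[OF q_compress_strong])
    moreover have "(\<lambda>n. (q (Suc n) o\<^sub>L \<theta> z o\<^sub>L q (Suc n)) h) \<longlonglongrightarrow> (c *\<^sub>C z) h"
      unfolding eq scaleC_blinfun.rep_eq
      by (intro bounded_linear.tendsto[OF bounded_linear_scaleC] LIMSEQ_Suc[OF q_compress_strong])
    ultimately show "\<theta> z h = (c *\<^sub>C z) h" by (rule LIMSEQ_unique)
  qed
  moreover have "T z = x"
  proof -
    have "T z = T (q 0 o\<^sub>L z o\<^sub>L q 0)" by (simp add: q_def T_p_p)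
    also have "\<dots> = x" unfolding z(2) by (simp add: y_def scaleC_one T_E)
    finally show ?thesis .
  qed
  ultimately show thesis using z(1) that by blast
qed

section \<open>Compression identifies the two peripheral spaces\<close>

lemma norm_tau_le:
  assumes "x \<in> A" shows "norm (\<tau> x) \<le> norm x"
proof -
  have "\<tau> x = T (\<theta> (E x))" using T_theta[OF E_in_B[OF assms]] by (simp add: T_E)
  also have "norm \<dots> \<le> norm (\<theta> (E x))" by (rule norm_T_le)
  also have "\<dots> \<le> norm (E x)" by (rule theta.contractive[OF E_in_B[OF assms]])
  also have "\<dots> \<le> norm x" by (rule norm_E_le)
  finally show ?thesis .
qed

sublocale tau: linear_contraction A \<tau>
proof
  show "csubspace A" "complete A"
    using concrete_cstar_von_neumann[OF A] by (simp_all add: concrete_cstar_algebra_def complete_eq_closed)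
  show "\<tau> ` A \<subseteq> A" "clinear_on A \<tau>" using tau by (simp_all add: normal_ucp_map_def)
qed (rule norm_tau_le)

abbreviation P\<theta> where "P\<theta> \<equiv> peripheral_space B \<theta>"
abbreviation P\<tau> where "P\<tau> \<equiv> peripheral_space A \<tau>"

lemma T_maps_peripheral: "z \<in> P\<theta> \<Longrightarrow> T z \<in> P\<tau>"
proof -
  have "closed (T -` P\<tau>)"
    by (intro continuous_closed_vimage closed_peripheral_space linear_continuous_at bounded_linear_T)
  moreover have "csubspace (T -` P\<tau>)"
    using csubspace_peripheral_space[of A \<tau>] T_scaleC[of 0]
    by (auto simp: complex_vector.subspace_def T_add T_scaleC)
  ultimately have "P\<theta> \<subseteq> T -` P\<tau>"
  proof (intro peripheral_space_minimal)
    fix z c assume z: "z \<in> B" "cmod c = 1" "\<theta> z = c *\<^sub>C z"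
    have "\<tau> (T z) = c *\<^sub>C T z" using T_theta[OF z(1)] by (simp add: z(3) T_scaleC)
    then show "z \<in> T -` P\<tau>" using eigenvector_in_peripheral_space[OF T_in_A[OF z(1)] z(2)] by simp
  qed
  then show "z \<in> P\<theta> \<Longrightarrow> T z \<in> P\<tau>" by blast
qed

lemma T_theta_iterate: "z \<in> B \<Longrightarrow> T ((\<theta> ^^ n) z) = (\<tau> ^^ n) (T z)"
  by (induction n) (simp_all add: T_theta theta_in_B)

text \<open>Write \<open>z = \<theta>\<^sup>n(w)\<close> with \<open>w\<close> peripheral. Then the corner \<open>q\<^sub>n z q\<^sub>n = \<theta>\<^sup>n(pwp)\<close> has norm at most
  \<open>\<parallel>T w\<parallel>\<close>, and \<open>T w\<close> has the same norm as \<open>\<tau>\<^sup>n(T w) = T z\<close> by recurrence for \<open>\<tau>\<close>.\<close>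

lemma T_isometric:
  assumes z: "z \<in> P\<theta>" shows "norm (T z) = norm z"
proof (rule antisym[OF norm_T_le])
  have le: "norm (q n o\<^sub>L z o\<^sub>L q n) \<le> norm (T z)" for n
  proof -
    obtain w where w: "w \<in> P\<theta>" "z = (\<theta> ^^ n) w"
      using z theta.peripheral_iterate_bij[of n] by (auto simp: bij_betw_def)
    have wB: "w \<in> B" using w(1) theta.peripheral_subset by blast
    have "q n o\<^sub>L z o\<^sub>L q n = (\<theta> ^^ n) (E (T w))"
      unfolding E_T q_def w(2) by (simp add: theta_mult B_mult p_in_B wB)
    also have "norm \<dots> \<le> norm (E (T w))" by (rule theta_norm_le[OF E_in_B[OF T_in_A[OF wB]]])
    also have "\<dots> \<le> norm (T w)" by (rule norm_E_le)
    also have "\<dots> = norm ((\<tau> ^^ n) (T w))"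
      by (rule tau.peripheral_iterate_isometric[OF T_maps_peripheral[OF w(1)], symmetric])
    also have "\<dots> = norm (T z)" by (simp add: w(2) T_theta_iterate wB)
    finally show ?thesis .
  qed
  show "norm z \<le> norm (T z)"
  proof (rule norm_blinfun_bound)
    fix h
    show "norm (z h) \<le> norm (T z) * norm h"
    proof (rule LIMSEQ_le_const2[OF tendsto_norm[OF q_compress_strong]], intro exI allI impI)
      show "norm ((q n o\<^sub>L z o\<^sub>L q n) h) \<le> norm (T z) * norm h" for n
        by (rule order_trans[OF norm_blinfun]) (intro mult_right_mono le norm_ge_zero)
    qed
  qed simp
qed

text \<open>The image is a complete subspace by isometry, and it contains all eigenvectors by lifting.\<close>

lemma T_bij: "bij_betw T P\<theta> P\<tau>"
proof -
  have diff: "T y - T z = T (y - z)" for y z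
    by (simp add: linear_diff[OF bounded_linear.linear[OF bounded_linear_T]])
  have dist: "dist (T y) (T z) = dist y z" if "y \<in> P\<theta>" "z \<in> P\<theta>" for y z
    using T_isometric[OF complex_vector.subspace_diff[OF csubspace_peripheral_space that]]
    by (simp add: dist_norm diff)
  have "inj_on T P\<theta>" by (rule inj_onI) (metis dist dist_eq_0_iff)
  moreover have "P\<tau> \<subseteq> T ` P\<theta>"
  proof (rule peripheral_space_minimal)
    show "closed (T ` P\<theta>)"
      by (intro complete_imp_closed complete_isometric_image_on theta.peripheral_complete dist)
    show "csubspace (T ` P\<theta>)"
      unfolding complex_vector.subspace_def
    proof (intro conjI ballI allI; (elim imageE)?)
      have "T 0 = 0" using T_scaleC[of 0 0] by simp
      then show "0 \<in> T ` P\<theta>"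
        using complex_vector.subspace_0[OF csubspace_peripheral_space] by (metis imageI)
    next
      fix x y u v assume "x = T u" "u \<in> P\<theta>" "y = T v" "v \<in> P\<theta>"
      then show "x + y \<in> T ` P\<theta>"
        using complex_vector.subspace_add[OF csubspace_peripheral_space] by (metis T_add imageI)
    next
      fix c x u assume "x = T u" "u \<in> P\<theta>"
      then show "c *\<^sub>C x \<in> T ` P\<theta>"
        using complex_vector.subspace_scale[OF csubspace_peripheral_space] by (metis T_scaleC imageI)
    qed
    fix x c assume x: "x \<in> A" "cmod c = 1" "\<tau> x = c *\<^sub>C x"
    then obtain z where "z \<in> B" "\<theta> z = c *\<^sub>C z" "T z = x" using eigenvector_lift by blast
    then show "x \<in> T ` P\<theta>" using eigenvector_in_peripheral_space x(2) by blast
  qed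
  ultimately show ?thesis using T_maps_peripheral by (auto simp: bij_betw_def)
qed

section \<open>The peripheral Poisson boundary and its automorphism\<close>

abbreviation boundary where "boundary \<equiv> poisson_boundary A \<tau> V B \<theta>"

lemma boundary_mult: "\<lbrakk>y \<in> P\<theta>; z \<in> P\<theta>\<rbrakk> \<Longrightarrow> T y \<otimes>\<^bsub>boundary\<^esub> T z = T (y o\<^sub>L z)"
  using the_inv_into_f_f[of T P\<theta>] T_bij
  by (simp add: poisson_boundary_def peripheral_lift_def bij_betw_def)

lemma concrete_P\<theta>: "concrete_cstar_algebra P\<theta>"
  by (rule concrete_cstar_peripheral[OF B dilation_facts(4)])

lemma P\<theta>_facts: "z \<in> P\<theta> \<Longrightarrow> z \<in> B" "z \<in> P\<theta> \<Longrightarrow> z \<in> bops" "z \<in> P\<theta> \<Longrightarrow> adj z \<in> P\<theta>"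
  "\<lbrakk>y \<in> P\<theta>; z \<in> P\<theta>\<rbrakk> \<Longrightarrow> y o\<^sub>L z \<in> P\<theta>"
  using theta.peripheral_subset concrete_P\<theta> by (auto simp: concrete_cstar_algebra_def)

lemma T_star_hom: "unital_star_hom (operator_algebra P\<theta>) boundary T"
proof -
  have "T id_blinfun = id_blinfun" by (rule blinfun_eqI) (simp add: T_apply adjV_V)
  then show ?thesis
    unfolding unital_star_hom_def clinear_on_def
    using T_maps_peripheral
    by (auto simp: boundary_mult T_add T_scaleC T_adj P\<theta>_facts) (auto simp: poisson_boundary_def)
qed

lemma boundary_cstar: "unital_cstar_algebra boundary"
proof (rule unital_cstar_algebra_isometric_image[OF _ T_star_hom])
  show "unital_cstar_algebra (operator_algebra P\<theta>)"
    by (rule unital_cstar_algebra_concrete[OF concrete_P\<theta>])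
  show "T ` cs_carrier (operator_algebra P\<theta>) = cs_carrier boundary"
    using T_bij by (simp add: poisson_boundary_def bij_betw_def)
qed (simp add: T_isometric)

text \<open>On lifts, \<open>\<tau>\<close> acts as the \<open>*\<close>-homomorphism \<open>\<theta>\<close>.\<close>

lemma tau_star_hom: "unital_star_hom boundary boundary \<tau>"
  unfolding unital_star_hom_def
proof (intro conjI ballI)
  have carrier: "cs_carrier boundary = P\<tau>" and star: "cs_star boundary = adj"
    by (simp_all add: poisson_boundary_def)
  have lift: "\<exists>z\<in>P\<theta>. x = T z" if "x \<in> cs_carrier boundary" for x
    using that T_bij by (auto simp: carrier bij_betw_def)
  show "\<tau> ` cs_carrier boundary \<subseteq> cs_carrier boundary"
    using tau.peripheral_maps by (auto simp: carrier)
  show "clinear_on (cs_carrier boundary) \<tau>"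
    using tau.linear tau.peripheral_subset unfolding clinear_on_def carrier by blast
  show "\<tau> \<one>\<^bsub>boundary\<^esub> = \<one>\<^bsub>boundary\<^esub>"
    using tau by (simp add: poisson_boundary_def normal_ucp_map_def)
  fix x assume x: "x \<in> cs_carrier boundary"
  then obtain u where u: "u \<in> P\<theta>" "x = T u" using lift by blast
  have "\<tau> (adj (T u)) = adj (\<tau> (T u))"
    using theta_adj[of u 1] u(1)
    by (simp add: P\<theta>_facts theta.in_S B_bops flip: T_adj T_theta)
  then show "\<tau> (cs_star boundary x) = cs_star boundary (\<tau> x)" by (simp add: star u(2))
  fix y assume "y \<in> cs_carrier boundary"
  then obtain v where v: "v \<in> P\<theta>" "y = T v" using lift by blast
  have "\<tau> (T (u o\<^sub>L v)) = T (\<theta> u o\<^sub>L \<theta> v)"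
    using theta_mult[of u v 1] u(1) v(1) by (simp add: P\<theta>_facts flip: T_theta)
  then show "\<tau> (x \<otimes>\<^bsub>boundary\<^esub> y) = \<tau> x \<otimes>\<^bsub>boundary\<^esub> \<tau> y"
    using u v by (simp add: boundary_mult theta.peripheral_maps P\<theta>_facts flip: T_theta)
qed

end

theorem theorem2p12:
  fixes A :: "('h::chilbert_space \<Rightarrow>\<^sub>L 'h) set"
    and \<tau> :: "('h \<Rightarrow>\<^sub>L 'h) \<Rightarrow> ('h \<Rightarrow>\<^sub>L 'h)"
    and V :: "'h \<Rightarrow>\<^sub>L 'k::chilbert_space"
    and B :: "('k \<Rightarrow>\<^sub>L 'k) set"
    and \<theta> :: "('k \<Rightarrow>\<^sub>L 'k) \<Rightarrow> ('k \<Rightarrow>\<^sub>L 'k)"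
  assumes "separable_space (euclidean :: 'h topology)"
    and "separable_space (euclidean :: 'k topology)"
    and "von_neumann_algebra A"
    and "normal_ucp_map A \<tau>"
    and "minimal_dilation A \<tau> V B \<theta>"
  shows "cstar_automorphism (poisson_boundary A \<tau> V B \<theta>) \<tau> \<and>
    automorphism_boundary (poisson_boundary A \<tau> V B \<theta>) \<tau> = poisson_boundary A \<tau> V B \<theta>"
proof -
  interpret poisson_dilation A \<tau> V B \<theta> using assms by unfold_locales
  have "bij_betw \<tau> (cs_carrier boundary) (cs_carrier boundary)"
    using tau.peripheral_bij by (simp add: poisson_boundary_def)
  moreover have "automorphism_boundary boundary \<tau> = boundary"
    by (simp add: automorphism_boundary_def poisson_boundary_def tau.peripheral_space_of_peripheral_space)
  ultimately show ?thesis
    by (simp add: cstar_automorphism_def boundary_cstar tau_star_hom)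
qed

end
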